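(* Let $p$ be any prime, $n\ge 1$ an integer, and $P_n$ a Sylow $p$-subgroup of the symmetric group $S_{p^n}$. Then: (1) $C_{S_{p^n}}(P_n)=Z(P_n)$ and $N_{S_{p^n}}(P_n)/P_n\cong (C_{p-1})^n$. (2) $\operatorname{Aut}(P_n)$ has a normal Sylow $p$-subgroup, with factor group isomorphic to $(C_{p-1})^n$. So for $p=2$, $\operatorname{Aut}(P_n)$ is a $2$-group and $P_n$ is self-normalizing in $S_{p^n}$.
   Context: $C_m$ denotes the cyclic group of order $m$, and $(C_m)^n$ the direct product of $n$ copies of it. *)

theory Defs
  imports
    "HOL-Algebra.Sym_Groups"
    "HOL-Algebra.Bij"
    "HOL-Algebra.Group_Action"
    "HOL-Algebra.Sylow"
    "HOL-Algebra.Product_Groups"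
begin

text \<open>Normalizers, automorphism groups, symmetric groups (on \<open>{1..n}\<close>), cyclic groups and direct
  products are those of HOL-Algebra. A subgroup is a carrier set, so \<open>H\<close> as a group in its own
  right is \<open>G\<lparr>carrier := H\<rparr>\<close>.\<close>

definition centralizer :: "('a, 'b) monoid_scheme \<Rightarrow> 'a set \<Rightarrow> 'a set"
  where "centralizer G H = {g \<in> carrier G. \<forall>h \<in> H. g \<otimes>\<^bsub>G\<^esub> h = h \<otimes>\<^bsub>G\<^esub> g}"

definition center :: "('a, 'b) monoid_scheme \<Rightarrow> 'a set"
  where "center G = {z \<in> carrier G. \<forall>g \<in> carrier G. z \<otimes>\<^bsub>G\<^esub> g = g \<otimes>\<^bsub>G\<^esub> z}"

text \<open>Only finite groups are considered. As usual, a Sylow \<open>p\<close>-subgroup is a subgroup whose order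
  is the exact power of \<open>p\<close> dividing \<open>order G\<close>; it is trivial when \<open>p\<close> does not divide
  \<open>order G\<close>.\<close>

definition sylow_subgroup :: "nat \<Rightarrow> 'a set \<Rightarrow> ('a, 'b) monoid_scheme \<Rightarrow> bool"
  where "sylow_subgroup p P G \<longleftrightarrow>
    finite (carrier G) \<and> subgroup P G \<and> card P = p ^ multiplicity p (order G)"

definition finite_p_group :: "nat \<Rightarrow> ('a, 'b) monoid_scheme \<Rightarrow> bool"
  where "finite_p_group p G \<longleftrightarrow> group G \<and> finite (carrier G) \<and> (\<exists>k. order G = p ^ k)"

definition cyclic_power :: "nat \<Rightarrow> nat \<Rightarrow> (nat \<Rightarrow> int) monoid"
  where "cyclic_power m n = product_group {..<n} (\<lambda>_. integer_mod_group m)"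

end

theory Submission
  imports Defs "HOL-Number_Theory.Residue_Primitive_Roots"
begin

text \<open>
  Up to conjugation \<open>P\<^sub>n\<close> is the iterated wreath product, acting on words of length \<open>n\<close> over
  \<open>\<int>/p\<close> by \<open>z # x \<mapsto> (z + f x) # g x\<close> with \<open>f\<close> arbitrary and \<open>g \<in> P\<^bsub>n-1\<^esub>\<close>. Let \<open>K\<close> be the kernel of
  \<open>P\<^sub>n \<rightarrow> P\<^bsub>n-1\<^esub>\<close>, an elementary abelian group of order \<open>p ^ (p ^ (n - 1))\<close>.

  An abelian normal subgroup \<open>L\<close> not contained in \<open>K\<close> has an image \<open>E\<close> in \<open>P\<^bsub>n-1\<^esub>\<close> containing the
  center of \<open>P\<^bsub>n-1\<^esub>\<close>, so \<open>L \<inter> K\<close> consists of functions invariant under that center; bounding \<open>E\<close> by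
  induction gives \<open>|L| \<le> p ^ (2 * p ^ (n - 2))\<close>. For odd \<open>p\<close> this is less than \<open>|K|\<close>, so \<open>K\<close> is
  characteristic. For \<open>p = 2\<close> there is exactly one other candidate for the image of \<open>K\<close> under an
  automorphism, so the square of every automorphism preserves \<open>K\<close>.

  An automorphism of prime order \<open>q \<noteq> p\<close> that preserves \<open>K\<close> and acts trivially on \<open>P\<^sub>n/K\<close> and on the
  center is trivial. Hence, for odd \<open>p\<close>, the actions on the centers of \<open>P\<^sub>1, \<dots>, P\<^sub>n\<close> define a
  homomorphism \<open>Aut(P\<^sub>n) \<rightarrow> (C\<^bsub>p-1\<^esub>)\<^sup>n\<close> whose kernel is a \<open>p\<close>-group; it is onto, since scaling the
  coordinates normalizes \<open>P\<^sub>n\<close>. For \<open>p = 2\<close> the trivial homomorphism does the same.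

  The kernel is the normal Sylow subgroup of \<open>Aut(P\<^sub>n)\<close>. Composing with conjugation gives a map from the
  normalizer of \<open>P\<^sub>n\<close> onto \<open>(C\<^bsub>p-1\<^esub>)\<^sup>n\<close> whose kernel is a \<open>p\<close>-group containing \<open>P\<^sub>n\<close>, because
  \<open>C(P\<^sub>n) \<le> P\<^sub>n\<close>; since \<open>P\<^sub>n\<close> is Sylow, the kernel is \<open>P\<^sub>n\<close>.
\<close>

section \<open>Finite \<open>p\<close>-groups and Sylow subgroups\<close>

text \<open>The fibres of \<open>h\<close> are the cosets of its kernel, so the cosets biject with
  the image; Lagrange's theorem counts them.\<close>

lemma (in group_hom) card_image_times_kernel:
  assumes "finite (carrier G)"
  shows "card (h ` carrier G) * card (kernel G H h) = card (carrier G)"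
proof -
  let ?K = "kernel G H h"
  have "inj_on (\<lambda>X. the_elem (h ` X)) (rcosets ?K)"
    using FactGroup_inj_on by (simp add: FactGroup_def)
  moreover have "(\<lambda>X. the_elem (h ` X)) ` (rcosets ?K) = h ` carrier G"
  proof -
    have "the_elem (h ` (?K #> x)) = h x" if x: "x \<in> carrier G" for x
    proof -
      have "h y = h x" if "y \<in> ?K #> x" for y
        using that x by (auto simp: r_coset_def kernel_def)
      moreover have "x \<in> ?K #> x" by (rule G.rcos_self[OF x subgroup_kernel])
      ultimately have "h ` (?K #> x) = {h x}" by blast
      then show ?thesis by simp
    qed
    then show ?thesis by (auto simp: RCOSETS_def image_UN)
  qed
  ultimately have "card (rcosets ?K) = card (h ` carrier G)"
    by (metis card_image)
  then show ?thesis
    using G.lagrange[OF subgroup_kernel] by (simp add: order_def)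
qed

lemma (in group_hom) card_subgroup_image:
  assumes "finite (carrier G)" "subgroup L G"
  shows "card L = card (h ` L) * card (L \<inter> kernel G H h)"
proof -
  interpret L: group_hom "G\<lparr>carrier := L\<rparr>" H h
    using induced_group_hom'[OF assms(2)] .
  have "kernel (G\<lparr>carrier := L\<rparr>) H h = L \<inter> kernel G H h"
    using subgroup.subset[OF assms(2)] by (auto simp: kernel_def)
  moreover have "finite L"
    using subgroup.subset[OF assms(2)] assms(1) by (rule finite_subset)
  then have "card (h ` L) * card (kernel (G\<lparr>carrier := L\<rparr>) H h) = card L"
    using L.card_image_times_kernel by simp
  ultimately show ?thesis by (simp only:)
qed

lemma nat_eq_prime_power:
  fixes m p :: nat
  assumes "prime p" "m > 0" "\<And>q. prime q \<Longrightarrow> q dvd m \<Longrightarrow> q = p"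
  shows "\<exists>k. m = p ^ k"
proof -
  have "m \<noteq> 0" "\<not> is_unit p" using assms(2) prime_gt_1_nat[OF assms(1)] by simp_all
  then obtain c k where c: "m = p ^ k * c" "\<not> p dvd c" by (rule multiplicity_decompose')
  have "c = 1"
  proof (rule ccontr)
    assume "c \<noteq> 1"
    then obtain q where q: "prime q" "q dvd c" using prime_factor_nat by blast
    then show False using assms(3)[of q] c by auto
  qed
  then show ?thesis using c by auto
qed

text \<open>By Cauchy's theorem every prime divisor of the order is the order of an element. The
  criterion reduces showing that a kernel is a \<open>p\<close>-group to its elements of prime
  order.\<close>

lemma (in group) order_eq_prime_power:
  assumes "finite (carrier G)" "prime p"
    and "\<And>q x. prime q \<Longrightarrow> q \<noteq> p \<Longrightarrow> x \<in> carrier G \<Longrightarrow> x [^] q = \<one> \<Longrightarrow> x = \<one>"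
  shows "\<exists>k. order G = p ^ k"
proof (rule nat_eq_prime_power[OF assms(2)])
  show "order G > 0" using assms(1) by (simp add: order_gt_0_iff_finite)
next
  fix q :: nat assume q: "prime q" "q dvd order G"
  \<comment> \<open>Exponent 1 in Sylow's existence theorem gives a subgroup of order
    \<open>q\<close>, which amounts to Cauchy's theorem.\<close>
  then obtain m where "order G = q ^ 1 * m" by auto
  then obtain H where H: "subgroup H G" "card H = q ^ 1"
    using sylow_thm[OF q(1) is_group] assms(1) by blast
  interpret H: group "G\<lparr>carrier := H\<rparr>" using H(1) subgroup_imp_group by blast
  have "H \<noteq> {\<one>}" using H(2) q(1) by (auto simp: prime_nat_iff)
  moreover have "\<one> \<in> H" using H(1) subgroup.one_closed by blast
  ultimately obtain x where x: "x \<in> H" "x \<noteq> \<one>" by blast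
  have "x [^] q = \<one>"
    using H.pow_order_eq_1[of x] x(1) H(2) nat_pow_consistent[of x q H] by (simp add: order_def)
  then show "q = p" using assms(3)[OF q(1)] x subgroup.mem_carrier[OF H(1)] by blast
qed

section \<open>Fixed points of \<open>p\<close>-groups and their consequences\<close>

text \<open>Orbit sizes divide the group order, so every orbit other than a single fixed point has
  size divisible by \<open>p\<close>. The action is a plain function \<open>act\<close> with its
  laws, which keeps the applications short.\<close>

lemma (in group) p_group_card_fixed_points:
  assumes p: "prime p" and ord: "order G = p ^ k" and finE: "finite E"
    and closed: "\<And>g x. g \<in> carrier G \<Longrightarrow> x \<in> E \<Longrightarrow> act g x \<in> E"
    and act_mult: "\<And>g h x. g \<in> carrier G \<Longrightarrow> h \<in> carrier G \<Longrightarrow> x \<in> E \<Longrightarrow> act (g \<otimes> h) x = act g (act h x)"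
    and act_one: "\<And>x. x \<in> E \<Longrightarrow> act \<one> x = x"
  shows "[card E = card {x \<in> E. \<forall>g \<in> carrier G. act g x = x}] (mod p)"
proof -
  \<comment> \<open>Elements of \<open>BijGroup E\<close> are extensional, hence the restriction of
    \<open>act g\<close> to \<open>E\<close>.\<close>
  define \<phi> where "\<phi> g = restrict (act g) E" for g
  have bij: "\<phi> g \<in> Bij E" if g: "g \<in> carrier G" for g
  proof -
    have "bij_betw (act g) E E"
      by (rule bij_betwI[of _ _ _ "act (inv g)"])
        (use g closed act_one in \<open>auto simp flip: act_mult\<close>)
    then show ?thesis by (auto simp: Bij_def \<phi>_def cong: bij_betw_cong)
  qed
  have "\<phi> \<in> hom G (BijGroup E)"
  proof (rule homI)
    fix g h assume gh: "g \<in> carrier G" "h \<in> carrier G"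
    then have "\<phi> (g \<otimes> h) = compose E (\<phi> g) (\<phi> h)"
      by (auto simp: \<phi>_def compose_def restrict_def fun_eq_iff act_mult closed)
    then show "\<phi> (g \<otimes> h) = \<phi> g \<otimes>\<^bsub>BijGroup E\<^esub> \<phi> h"
      using gh bij by (simp add: BijGroup_def)
  qed (use bij in \<open>simp add: BijGroup_def\<close>)
  then interpret group_action G E \<phi>
    by (simp add: group_action_def group_hom_def group_hom_axioms_def group_BijGroup is_group)
  define O1 where "O1 = {X \<in> orbits G E \<phi>. card X = 1}"
  have orb: "orbits G E \<phi> = orbit G \<phi> ` E" by (auto simp: orbits_def)
  have finO: "finite (orbits G E \<phi>)" by (simp add: orb finE)
  have finX: "finite X" if "X \<in> orbits G E \<phi>" for X
    using that orbits_coverture finE by (metis Union_upper finite_subset)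
  have fix_orb: "card (orbit G \<phi> x) = 1 \<longleftrightarrow> (\<forall>g \<in> carrier G. act g x = x)" if x: "x \<in> E" for x
  proof -
    have mem: "x \<in> orbit G \<phi> x" using orbit_refl[OF x] .
    have "card (orbit G \<phi> x) = 1 \<longleftrightarrow> orbit G \<phi> x = {x}"
      using mem by (auto simp: card_1_singleton_iff)
    also have "\<dots> \<longleftrightarrow> (\<forall>g \<in> carrier G. act g x = x)"
      using mem x by (auto simp: orbit_def \<phi>_def)
    finally show ?thesis .
  qed
  have O1: "card {x \<in> E. \<forall>g \<in> carrier G. act g x = x} = card O1"
  proof (rule bij_betw_same_card)
    show "bij_betw (\<lambda>x. {x}) {x \<in> E. \<forall>g \<in> carrier G. act g x = x} O1"
    proof (rule bij_betw_imageI)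
      show "(\<lambda>x. {x}) ` {x \<in> E. \<forall>g \<in> carrier G. act g x = x} = O1"
      proof (intro subset_antisym subsetI)
        fix X assume "X \<in> (\<lambda>x. {x}) ` {x \<in> E. \<forall>g \<in> carrier G. act g x = x}"
        then obtain x where x: "x \<in> E" "\<forall>g \<in> carrier G. act g x = x" "X = {x}" by auto
        then have "card (orbit G \<phi> x) = 1" using fix_orb by blast
        with orbit_refl[OF x(1)] x have "orbit G \<phi> x = X" by (auto simp: card_1_singleton_iff)
        with x show "X \<in> O1" by (auto simp: O1_def orb)
      next
        fix X assume "X \<in> O1"
        then obtain x where x: "x \<in> E" "X = orbit G \<phi> x" "card X = 1" by (auto simp: O1_def orb)
        with orbit_refl[OF x(1)] have "X = {x}" by (auto simp: card_1_singleton_iff)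
        with x fix_orb[OF x(1)] show "X \<in> (\<lambda>x. {x}) ` {x \<in> E. \<forall>g \<in> carrier G. act g x = x}"
          by auto
      qed
    qed auto
  qed
  have "card E = (\<Sum>X\<in>orbits G E \<phi>. card X)"
    using disjoint_sum[OF finE, of "\<lambda>_. 1::nat"] by simp
  also have "\<dots> = (\<Sum>X\<in>O1. card X) + (\<Sum>X\<in>orbits G E \<phi> - O1. card X)"
    using sum.subset_diff[of O1 "orbits G E \<phi>" card] finO by (simp add: O1_def add.commute)
  also have "(\<Sum>X\<in>O1. card X) = card O1" by (simp add: O1_def)
  finally have eq: "card E = card O1 + (\<Sum>X\<in>orbits G E \<phi> - O1. card X)" .
  have "p dvd (\<Sum>X\<in>orbits G E \<phi> - O1. card X)"
  proof (rule dvd_sum)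
    fix X assume X: "X \<in> orbits G E \<phi> - O1"
    then obtain x where x: "x \<in> E" "X = orbit G \<phi> x" by (auto simp: orb)
    then have "card X dvd p ^ k" using orbit_stabilizer_theorem[OF x(1)] ord by (metis dvd_triv_left)
    then obtain j where "card X = p ^ j" using p divides_primepow_nat by blast
    then show "p dvd card X" using X by (cases j) (auto simp: O1_def)
  qed
  then show ?thesis unfolding O1 by (subst eq) (auto simp: cong_def elim: dvdE)
qed

text \<open>Under conjugation by \<open>G\<close> the fixed points in \<open>N\<close> are its
  central elements. Their number is congruent to \<open>card N\<close> and so divisible by
  \<open>p\<close>; as the identity is one of them, there are others.\<close>

lemma (in group) p_group_normal_meets_center:
  assumes p: "prime p" and ord: "order G = p ^ k"
    and N: "N \<lhd> G" "N \<noteq> {\<one>}"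
  obtains z where "z \<in> N" "z \<noteq> \<one>" "z \<in> center G"
proof -
  interpret N: normal N G by fact
  have finG: "finite (carrier G)"
    using ord p by (metis order_gt_0_iff_finite prime_gt_0_nat zero_less_power)
  then have finN: "finite N" using N.subset finite_subset by blast
  define F where "F = {x \<in> N. \<forall>g \<in> carrier G. g \<otimes> x \<otimes> inv g = x}"
  have "[card N = card F] (mod p)"
    unfolding F_def
  proof (rule p_group_card_fixed_points[OF p ord finN])
    fix g h x assume "g \<in> carrier G" "h \<in> carrier G" "x \<in> N"
    then show "g \<otimes> h \<otimes> x \<otimes> inv (g \<otimes> h) = g \<otimes> (h \<otimes> x \<otimes> inv h) \<otimes> inv g"
      using N.subset by (simp add: inv_mult_group m_assoc subset_iff)
  qed (use N.subset N.inv_op_closed2 in \<open>auto simp: subset_iff\<close>)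
  moreover have "p dvd card N"
  proof -
    have "card N dvd p ^ k" using lagrange[OF N.subgroup_axioms] ord by (metis dvd_triv_right)
    then obtain j where j: "card N = p ^ j" using p divides_primepow_nat by blast
    have "card N \<noteq> 1" using N(2) N.one_closed by (metis card_1_singletonE singletonD)
    with j show ?thesis by (cases j) auto
  qed
  ultimately have "p dvd card F" by (metis cong_dvd_iff)
  moreover have "\<one> \<in> F" by (auto simp: F_def N.one_closed)
  moreover have "finite F" using finN by (simp add: F_def)
  ultimately have "card F \<noteq> 1" "F \<noteq> {}" using p by auto
  then have "F \<noteq> {\<one>}" by auto
  with \<open>\<one> \<in> F\<close> obtain z where z: "z \<in> F" "z \<noteq> \<one>" by blast
  then have zN: "z \<in> N" "z \<in> carrier G" using N.subset by (auto simp: F_def)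
  have "z \<otimes> g = g \<otimes> z" if g: "g \<in> carrier G" for g
  proof -
    have "z = g \<otimes> z \<otimes> inv g" using z(1) g by (simp add: F_def)
    then show ?thesis using inv_solve_right[of z "g \<otimes> z" g] g zN by simp
  qed
  then have "z \<in> center G" using zN by (simp add: center_def)
  with z zN show ?thesis using that by blast
qed

text \<open>\<open>P\<close> acts on the right cosets of \<open>Q\<close>, whose number is prime to
  \<open>p\<close>. Hence \<open>P\<close> fixes some coset of \<open>Q\<close>, which puts
  \<open>P\<close> inside a conjugate of \<open>Q\<close>; equal orders do the rest.\<close>

lemma (in group) sylow_subgroups_conjugate:
  assumes p: "prime p" and P: "sylow_subgroup p P G" and Q: "sylow_subgroup p Q G"
  obtains g where "g \<in> carrier G" "P = (\<lambda>x. g \<otimes> x \<otimes> inv g) ` Q"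
proof -
  have finG: "finite (carrier G)" and sP: "subgroup P G" and sQ: "subgroup Q G"
    and cP: "card P = p ^ multiplicity p (order G)" and cQ: "card Q = p ^ multiplicity p (order G)"
    using P Q by (auto simp: sylow_subgroup_def)
  interpret P: group "G\<lparr>carrier := P\<rparr>" using sP subgroup_imp_group by blast
  have Pc: "P \<subseteq> carrier G" and Qc: "Q \<subseteq> carrier G" using sP sQ subgroup.subset by auto
  have invP: "inv\<^bsub>G\<lparr>carrier := P\<rparr>\<^esub> x = inv x" if "x \<in> P" for x
    using m_inv_consistent[OF sP that] .
  \<comment> \<open>The inverse turns right multiplication into a left action.\<close>
  define act where "act g X = X #> inv g" for g X
  define F where "F = {X \<in> rcosets Q. \<forall>g \<in> carrier (G\<lparr>carrier := P\<rparr>). act g X = X}"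
  have rc: "X \<subseteq> carrier G" if "X \<in> rcosets Q" for X
    using that Qc r_coset_subset_G by (auto simp: RCOSETS_def)
  have "[card (rcosets Q) = card F] (mod p)"
    unfolding F_def
  proof (rule P.p_group_card_fixed_points[OF p])
    show "order (G\<lparr>carrier := P\<rparr>) = p ^ multiplicity p (order G)" by (simp add: order_def cP)
    show "finite (rcosets Q)" using finG by (simp add: RCOSETS_def)
  next
    fix g X assume "g \<in> carrier (G\<lparr>carrier := P\<rparr>)" "X \<in> rcosets Q"
    then show "act g X \<in> rcosets Q"
      using Pc Qc by (force simp: act_def RCOSETS_def coset_mult_assoc)
  next
    fix g h X assume "g \<in> carrier (G\<lparr>carrier := P\<rparr>)" "h \<in> carrier (G\<lparr>carrier := P\<rparr>)" "X \<in> rcosets Q"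
    then show "act (g \<otimes>\<^bsub>G\<lparr>carrier := P\<rparr>\<^esub> h) X = act g (act h X)"
      using Pc rc by (simp add: act_def coset_mult_assoc subset_iff inv_mult_group)
  next
    fix X assume "X \<in> rcosets Q"
    then show "act \<one>\<^bsub>G\<lparr>carrier := P\<rparr>\<^esub> X = X"
      using rc by (simp add: act_def)
  qed
  moreover have "\<not> p dvd card (rcosets Q)"
  proof
    assume "p dvd card (rcosets Q)"
    then have "p ^ Suc (multiplicity p (order G)) dvd order G"
      using lagrange[OF sQ] cQ by (metis mult_dvd_mono dvd_refl power_Suc)
    moreover have "order G \<noteq> 0" "\<not> is_unit p" using finG p
      by (auto simp: order_gt_0_iff_finite[symmetric])
    ultimately show False
      using power_dvd_iff_le_multiplicity[of "order G" p "Suc (multiplicity p (order G))"] by simp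
  qed
  ultimately have "card F \<noteq> 0" by (metis cong_dvd_iff dvd_0_right)
  then obtain X where X: "X \<in> F" by fastforce
  then obtain a where a: "a \<in> carrier G" "X = Q #> a" by (auto simp: F_def RCOSETS_def)
  let ?c = "\<lambda>x. inv a \<otimes> x \<otimes> inv (inv a)"
  have "P \<subseteq> ?c ` Q"
  proof
    fix g assume g: "g \<in> P"
    then have gc: "g \<in> carrier G" using Pc by blast
    have "inv g \<in> P" by (rule subgroup.m_inv_closed[OF sP g])
    then have "act (inv g) X = X" using X by (simp add: F_def)
    then have eq: "Q #> a #> g = Q #> a" using a gc by (simp add: act_def)
    have "a \<in> Q #> a" using a(1) sQ by (rule rcos_self)
    then have "a \<otimes> g \<in> Q #> a #> g" unfolding r_coset_def[of G "Q #> a"] by blast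
    then obtain q where q: "q \<in> Q" "a \<otimes> g = q \<otimes> a" unfolding eq by (auto simp: r_coset_def)
    have qc: "q \<in> carrier G" using q Qc by blast
    have "g = inv a \<otimes> (a \<otimes> g)" using a gc by (simp flip: m_assoc)
    also have "\<dots> = ?c q" using a qc by (simp add: q m_assoc)
    finally show "g \<in> ?c ` Q" using q by blast
  qed
  moreover have "card (?c ` Q) = card P"
  proof -
    have "inj_on ?c Q" using a Qc by (auto simp: inj_on_def subset_iff)
    then show ?thesis using cP cQ by (simp add: card_image)
  qed
  moreover have "finite (?c ` Q)" using finG Qc finite_subset by blast
  ultimately have "P = ?c ` Q" by (simp add: card_subset_eq)
  with a that[of "inv a"] show ?thesis by auto
qed

section \<open>Automorphisms\<close>

lemma (in group) pow_coprime_eq_one: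
  fixes m k :: nat
  assumes "x \<in> carrier G" "x [^] m = \<one>" "x [^] k = \<one>" "coprime m k"
  shows "x = \<one>"
proof -
  have "ord x dvd m" "ord x dvd k" using assms by (simp_all flip: pow_eq_id)
  with assms(4) have "ord x = 1" by (metis coprime_common_divisor_nat)
  with assms(1) show ?thesis using ord_eq_1 by blast
qed

lemma (in group) hom_funpow_closed:
  assumes "\<alpha> \<in> hom G G" "x \<in> carrier G"
  shows "(\<alpha> ^^ i) x \<in> carrier G"
  using assms by (induction i) (auto simp: hom_def)

text \<open>Since \<alpha> fixes \<open>z\<close>, its \<open>i\<close>-th iterate multiplies
  \<open>y\<close> by the \<open>i\<close>-th power of \<open>z\<close>. Returning to
  \<open>y\<close> after \<open>q\<close> steps makes the order of \<open>z\<close> divide both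
  \<open>p\<close> and \<open>q\<close>.\<close>

lemma (in group) hom_shift_trivial:
  assumes \<alpha>: "\<alpha> \<in> hom G G" and y: "y \<in> carrier G" "z \<in> carrier G"
    and eq: "\<alpha> y = z \<otimes> y" "\<alpha> z = z"
    and per: "(\<alpha> ^^ q) y = y" and zp: "z [^] (p::nat) = \<one>" and cop: "coprime p (q::nat)"
  shows "z = \<one>"
proof -
  interpret \<alpha>: group_hom G G \<alpha> using \<alpha> by unfold_locales
  have "(\<alpha> ^^ i) y = z [^] i \<otimes> y" for i :: nat
  proof (induction i)
    case (Suc i)
    then show ?case using y eq by (simp add: \<alpha>.hom_nat_pow m_assoc)
  qed (use y in auto)
  then have "z [^] q = \<one>" using per y by (metis nat_pow_closed r_cancel_one)
  with zp cop y(2) show ?thesis by (blast intro: pow_coprime_eq_one)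
qed

text \<open>The commutators \<open>\<alpha>(y) y\<^sup>-\<^sup>1\<close> with \<open>y \<in> K\<close> form a normal subgroup. If it were nontrivial it would
  contain a central \<open>z \<noteq> 1\<close>, which \<open>\<alpha>\<close> fixes, and then \<open>y = \<alpha>\<^sup>q(y) = z\<^sup>q y\<close>.\<close>
lemma (in group) coprime_automorphism_trivial:
  assumes p: "prime p" and q: "prime q" "q \<noteq> p" and ord: "order G = p ^ k"
    and K: "K \<lhd> G" and comm: "\<And>x y. x \<in> K \<Longrightarrow> y \<in> K \<Longrightarrow> x \<otimes> y = y \<otimes> x"
    and expo: "\<And>x. x \<in> K \<Longrightarrow> x [^] p = \<one>"
    and \<alpha>: "\<alpha> \<in> hom G G" and per: "\<And>x. x \<in> carrier G \<Longrightarrow> (\<alpha> ^^ q) x = x"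
    and quot: "\<And>x. x \<in> carrier G \<Longrightarrow> \<alpha> x \<otimes> inv x \<in> K"
    and cent: "\<And>z. z \<in> K \<Longrightarrow> z \<in> center G \<Longrightarrow> \<alpha> z = z"
    and x: "x \<in> carrier G"
  shows "\<alpha> x = x"
proof -
  interpret \<alpha>: group_hom G G \<alpha> using \<alpha> by unfold_locales
  interpret K: normal K G by fact
  have Kc: "x \<in> carrier G" if "x \<in> K" for x using that K.subset by blast
  have cop: "coprime p q" using p q by (simp add: primes_coprime)
  define D where "D = (\<lambda>y. \<alpha> y \<otimes> inv y) ` K"
  have DK: "D \<subseteq> K" using quot Kc by (auto simp: D_def)
  have comm3: "inv a \<otimes> b = b \<otimes> inv a" if "a \<in> K" "b \<in> K" for a b
    using comm that K.m_inv_closed by blast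
  have \<alpha>K: "\<alpha> a \<in> K" if "a \<in> K" for a
  proof -
    have "\<alpha> a = (\<alpha> a \<otimes> inv a) \<otimes> a" using Kc[OF that] by (simp add: m_assoc)
    then show ?thesis using quot[OF Kc[OF that]] that K.m_closed by metis
  qed
  have "D \<lhd> G"
  proof (rule normal_invI)
    show "subgroup D G"
    proof (rule subgroupI)
      show "D \<subseteq> carrier G" using DK Kc by blast
      show "D \<noteq> {}" unfolding D_def using K.one_closed by blast
    next
      fix a assume "a \<in> D"
      then obtain y where y: "y \<in> K" "a = \<alpha> y \<otimes> inv y" by (auto simp: D_def)
      have "inv a = \<alpha> (inv y) \<otimes> inv (inv y)"
        using y Kc \<alpha>K comm3[OF \<alpha>K[OF y(1)] y(1)] by (simp add: inv_mult_group)
      then show "inv a \<in> D" using y K.m_inv_closed[OF y(1)] by (simp only: D_def image_eqI)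
    next
      fix a b assume "a \<in> D" "b \<in> D"
      then obtain y w where y: "y \<in> K" "a = \<alpha> y \<otimes> inv y" "w \<in> K" "b = \<alpha> w \<otimes> inv w"
        by (auto simp: D_def)
      have "a \<otimes> b = \<alpha> y \<otimes> (inv y \<otimes> (\<alpha> w \<otimes> inv w))" using y Kc by (simp add: m_assoc)
      also have "inv y \<otimes> (\<alpha> w \<otimes> inv w) = (\<alpha> w \<otimes> inv w) \<otimes> inv y"
        using comm3[OF y(1), of "\<alpha> w \<otimes> inv w"] quot[OF Kc[OF y(3)]] by simp
      also have "\<alpha> y \<otimes> ((\<alpha> w \<otimes> inv w) \<otimes> inv y) = \<alpha> (y \<otimes> w) \<otimes> inv (y \<otimes> w)"
        using y Kc by (simp add: m_assoc inv_mult_group)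
      finally show "a \<otimes> b \<in> D" unfolding D_def using K.m_closed[OF y(1,3)] by (rule image_eqI)
    qed
  next
    fix g a assume g: "g \<in> carrier G" "a \<in> D"
    then obtain y where y: "y \<in> K" "a = \<alpha> y \<otimes> inv y" by (auto simp: D_def)
    \<comment> \<open>As \<alpha> multiplies \<open>g\<close> by an element \<open>c\<close> of the
      abelian \<open>K\<close>, and conjugation by \<open>c\<close> is trivial on \<open>K\<close>,
      the conjugate \<open>w\<close> of \<open>y\<close> goes to the conjugate of
      \<open>\<alpha> y\<close> by \<open>g\<close> itself.\<close>
    define c where "c = \<alpha> g \<otimes> inv g"
    define w where "w = g \<otimes> y \<otimes> inv g"
    have c: "c \<in> K" using quot g by (simp add: c_def)
    have w: "w \<in> K" using y g K.inv_op_closed2 by (simp add: w_def)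
    have m: "g \<otimes> \<alpha> y \<otimes> inv g \<in> K" using \<alpha>K[OF y(1)] g K.inv_op_closed2 by simp
    have "\<alpha> g = c \<otimes> g" using g by (simp add: c_def m_assoc)
    then have "\<alpha> w = c \<otimes> (g \<otimes> \<alpha> y \<otimes> inv g) \<otimes> inv c"
      using g y Kc c by (simp add: w_def inv_mult_group m_assoc)
    also have "\<dots> = (g \<otimes> \<alpha> y \<otimes> inv g) \<otimes> c \<otimes> inv c" using comm[OF c m] by simp
    also have "\<dots> = g \<otimes> \<alpha> y \<otimes> inv g" using Kc[OF m] Kc[OF c] by (simp add: m_assoc)
    finally have \<alpha>w: "\<alpha> w = g \<otimes> \<alpha> y \<otimes> inv g" .
    have cancel: "inv g \<otimes> (g \<otimes> b) = b" if "b \<in> carrier G" for b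
      using g(1) that by (simp flip: m_assoc)
    have "inv w = g \<otimes> inv y \<otimes> inv g" using g(1) Kc[OF y(1)] by (simp add: w_def inv_mult_group m_assoc)
    then have "\<alpha> w \<otimes> inv w = g \<otimes> a \<otimes> inv g"
      using g(1) Kc[OF y(1)] by (simp add: \<alpha>w y(2) m_assoc cancel)
    then show "g \<otimes> a \<otimes> inv g \<in> D" using w by (metis D_def imageI)
  qed
  have "D = {\<one>}"
  proof (rule ccontr)
    assume "D \<noteq> {\<one>}"
    from p_group_normal_meets_center[OF p ord \<open>D \<lhd> G\<close> this]
    obtain z where z: "z \<in> D" "z \<noteq> \<one>" "z \<in> center G" .
    then obtain y where y: "y \<in> K" "z = \<alpha> y \<otimes> inv y" by (auto simp: D_def)
    have zK: "z \<in> K" using z DK by blast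
    have "\<alpha> y = z \<otimes> y" using y Kc by (simp add: m_assoc)
    then have "z = \<one>"
      using hom_shift_trivial[OF \<alpha> Kc[OF y(1)] Kc[OF zK] _ cent[OF zK z(3)] per[OF Kc[OF y(1)]] expo[OF zK] cop]
      by simp
    with z show False by simp
  qed
  \<comment> \<open>With \<open>D\<close> trivial, \<alpha> fixes all of \<open>K\<close>, in
    particular the factor \<open>z\<close> by which it moves an arbitrary \<open>x\<close>; the
    shift argument then applies to \<open>x\<close>.\<close>
  define z where "z = \<alpha> x \<otimes> inv x"
  have zK: "z \<in> K" using quot x by (simp add: z_def)
  then have "\<alpha> z \<otimes> inv z \<in> D" by (auto simp: D_def)
  then have "\<alpha> z = z" using \<open>D = {\<one>}\<close> Kc[OF zK] inv_solve_right[of \<one> "\<alpha> z" z] by simp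
  have "\<alpha> x = z \<otimes> x" using x by (simp add: z_def m_assoc)
  then have "z = \<one>"
    using hom_shift_trivial[OF \<alpha> x Kc[OF zK] _ \<open>\<alpha> z = z\<close> per[OF x] expo[OF zK] cop] by simp
  with \<open>\<alpha> x = z \<otimes> x\<close> x show ?thesis by simp
qed

section \<open>The automorphism group as a group of extensional maps\<close>

lemma carrier_AutoGroup [simp]: "carrier (AutoGroup G) = auto G"
  by (simp add: AutoGroup_def)

lemma mult_AutoGroup:
  "\<alpha> \<in> auto G \<Longrightarrow> \<beta> \<in> auto G \<Longrightarrow> \<alpha> \<otimes>\<^bsub>AutoGroup G\<^esub> \<beta> = compose (carrier G) \<alpha> \<beta>"
  by (simp add: AutoGroup_def BijGroup_def auto_def)

lemma one_AutoGroup: "\<one>\<^bsub>AutoGroup G\<^esub> = (\<lambda>x\<in>carrier G. x)"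
  by (simp add: AutoGroup_def BijGroup_def)

lemma autoI:
  assumes "\<alpha> \<in> hom G G" "\<alpha> \<in> extensional (carrier G)" "bij_betw \<alpha> (carrier G) (carrier G)"
  shows "\<alpha> \<in> auto G"
  using assms by (simp add: auto_def Bij_def)

lemma auto_hom: "\<alpha> \<in> auto G \<Longrightarrow> \<alpha> \<in> hom G G"
  and auto_bij: "\<alpha> \<in> auto G \<Longrightarrow> bij_betw \<alpha> (carrier G) (carrier G)"
  and auto_extensional: "\<alpha> \<in> auto G \<Longrightarrow> \<alpha> \<in> extensional (carrier G)"
  by (auto simp: auto_def Bij_def)

lemma auto_closed: "\<alpha> \<in> auto G \<Longrightarrow> x \<in> carrier G \<Longrightarrow> \<alpha> x \<in> carrier G"
  using auto_hom by (auto simp: hom_def)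

lemma auto_eqI:
  assumes "\<alpha> \<in> auto G" "\<beta> \<in> auto G" "\<And>x. x \<in> carrier G \<Longrightarrow> \<alpha> x = \<beta> x"
  shows "\<alpha> = \<beta>"
  using assms auto_extensional extensionalityI by metis

lemma (in group) compose_auto:
  assumes "\<alpha> \<in> auto G" "\<beta> \<in> auto G"
  shows "compose (carrier G) \<alpha> \<beta> \<in> auto G"
  using monoid.m_closed[OF group.is_monoid[OF AutoGroup], of \<alpha> \<beta>] assms
  by (simp add: mult_AutoGroup)

text \<open>Turns the order of an automorphism into periodicity of plain iterates. The equation is
  pointwise on the carrier because \<open>\<alpha> ^^ 0\<close> need not be extensional.\<close>

lemma (in group) pow_AutoGroup:
  assumes "\<alpha> \<in> auto G" "x \<in> carrier G"
  shows "(\<alpha> [^]\<^bsub>AutoGroup G\<^esub> (i::nat)) x = (\<alpha> ^^ i) x"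
  using assms(2)
proof (induction i arbitrary: x)
  case 0
  then show ?case by (simp add: one_AutoGroup)
next
  case (Suc i)
  interpret A: group "AutoGroup G" by (rule AutoGroup)
  have "\<alpha> [^]\<^bsub>AutoGroup G\<^esub> i \<in> auto G" using A.nat_pow_closed[of \<alpha>] assms by simp
  then show ?case using Suc assms
    by (simp add: mult_AutoGroup compose_def auto_closed del: funpow.simps add: funpow_Suc_right)
qed

lemma finite_auto:
  assumes "finite (carrier G)"
  shows "finite (auto G)"
proof (rule finite_subset)
  show "auto G \<subseteq> (\<Pi>\<^sub>E x\<in>carrier G. carrier G)"
    by (auto simp: auto_def hom_def Bij_def PiE_def)
  show "finite (\<Pi>\<^sub>E x\<in>carrier G. carrier G)" using assms by (simp add: finite_PiE)
qed

lemma (in group) auto_image_normal: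
  assumes \<alpha>: "\<alpha> \<in> auto G" and L: "L \<lhd> G"
  shows "\<alpha> ` L \<lhd> G"
proof -
  have "group_hom G G \<alpha>"
    using \<alpha> is_group by (simp add: group_hom_def group_hom_axioms_def auto_hom)
  then show ?thesis
    using normal.surj_hom_normal_subgroup[OF L] auto_bij[OF \<alpha>] unfolding bij_betw_def by blast
qed

lemma (in group) conjugation_iso:
  assumes "c \<in> carrier G"
  shows "(\<lambda>x. c \<otimes> x \<otimes> inv c) \<in> iso G G"
proof (rule isoI)
  show "(\<lambda>x. c \<otimes> x \<otimes> inv c) \<in> hom G G"
  proof (rule homI)
    fix x y assume "x \<in> carrier G" "y \<in> carrier G"
    then show "c \<otimes> (x \<otimes> y) \<otimes> inv c = c \<otimes> x \<otimes> inv c \<otimes> (c \<otimes> y \<otimes> inv c)"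
      using assms by (simp add: m_assoc) (simp flip: m_assoc)
  qed (use assms in simp)
  show "bij_betw (\<lambda>x. c \<otimes> x \<otimes> inv c) (carrier G) (carrier G)"
  proof (rule bij_betwI[where g = "\<lambda>x. inv c \<otimes> x \<otimes> c"])
    fix x assume "x \<in> carrier G"
    then show "inv c \<otimes> (c \<otimes> x \<otimes> inv c) \<otimes> c = x" "c \<otimes> (inv c \<otimes> x \<otimes> c) \<otimes> inv c = x"
      using assms by (simp_all add: m_assoc) (simp_all flip: m_assoc)
  qed (use assms in auto)
qed

lemma auto_center:
  assumes G: "group G" and \<alpha>: "\<alpha> \<in> auto G" and c: "c \<in> center G"
  shows "\<alpha> c \<in> center G"
proof -
  have cG: "c \<in> carrier G" using c by (simp add: center_def)
  have "\<alpha> c \<otimes>\<^bsub>G\<^esub> y = y \<otimes>\<^bsub>G\<^esub> \<alpha> c" if "y \<in> carrier G" for y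
  proof -
    obtain x where x: "x \<in> carrier G" "y = \<alpha> x"
      using auto_bij[OF \<alpha>] \<open>y \<in> carrier G\<close> by (auto simp: bij_betw_def)
    then have "\<alpha> (c \<otimes>\<^bsub>G\<^esub> x) = \<alpha> (x \<otimes>\<^bsub>G\<^esub> c)" using c by (simp add: center_def)
    then show ?thesis using auto_hom[OF \<alpha>] x cG by (simp add: hom_def)
  qed
  then show ?thesis using auto_closed[OF \<alpha> cG] by (simp add: center_def)
qed

section \<open>Automorphisms induced on a quotient\<close>

definition descend :: "('a, 'c) monoid_scheme \<Rightarrow> ('b, 'd) monoid_scheme \<Rightarrow> ('a \<Rightarrow> 'b) \<Rightarrow> ('a \<Rightarrow> 'a) \<Rightarrow> 'b \<Rightarrow> 'b"
  where "descend G H h \<alpha> = (\<lambda>y\<in>carrier H. h (\<alpha> (SOME x. x \<in> carrier G \<and> h x = y)))"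

context group_hom
begin

text \<open>Two preimages differ by a kernel element, which \<alpha> keeps in the kernel, so the
  preimage chosen in \<open>descend\<close> does not matter.\<close>

lemma descend_apply:
  assumes \<alpha>: "\<alpha> \<in> hom G G" "\<And>k. k \<in> kernel G H h \<Longrightarrow> \<alpha> k \<in> kernel G H h"
    and x: "x \<in> carrier G"
  shows "descend G H h \<alpha> (h x) = h (\<alpha> x)"
proof -
  interpret \<alpha>: group_hom G G \<alpha> using \<alpha>(1) by unfold_locales
  define y where "y = (SOME y. y \<in> carrier G \<and> h y = h x)"
  have y: "y \<in> carrier G" "h y = h x"
    using someI[of "\<lambda>y. y \<in> carrier G \<and> h y = h x" x] x by (auto simp: y_def)
  have "inv x \<otimes> y \<in> kernel G H h" using x y by (simp add: kernel_def)
  then have "h (\<alpha> (inv x \<otimes> y)) = \<one>\<^bsub>H\<^esub>" using \<alpha>(2) by (auto simp: kernel_def)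
  then have "h (\<alpha> y) = h (\<alpha> x)"
    using x y H.inv_solve_left[of "\<one>\<^bsub>H\<^esub>" "h (\<alpha> x)" "h (\<alpha> y)"] by simp
  with x show ?thesis by (simp add: descend_def y_def)
qed

lemma descend_auto:
  assumes surj: "h ` carrier G = carrier H" and fin: "finite (carrier H)"
    and \<alpha>: "\<alpha> \<in> auto G" "\<And>k. k \<in> kernel G H h \<Longrightarrow> \<alpha> k \<in> kernel G H h"
  shows "descend G H h \<alpha> \<in> auto H"
proof (rule autoI)
  have ap: "descend G H h \<alpha> (h x) = h (\<alpha> x)" if "x \<in> carrier G" for x
    using descend_apply[OF auto_hom[OF \<alpha>(1)] \<alpha>(2) that] .
  show "descend G H h \<alpha> \<in> hom H H"
  proof (rule homI)
    fix a assume "a \<in> carrier H"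
    then obtain x where "x \<in> carrier G" "a = h x" using surj by blast
    then show "descend G H h \<alpha> a \<in> carrier H" using ap auto_closed[OF \<alpha>(1)] by simp
  next
    fix a b assume "a \<in> carrier H" "b \<in> carrier H"
    then obtain x y where xy: "x \<in> carrier G" "a = h x" "y \<in> carrier G" "b = h y" using surj by blast
    then have "descend G H h \<alpha> (a \<otimes>\<^bsub>H\<^esub> b) = h (\<alpha> (x \<otimes> y))" using ap[of "x \<otimes> y"] by simp
    also have "\<dots> = h (\<alpha> x) \<otimes>\<^bsub>H\<^esub> h (\<alpha> y)"
      using xy auto_closed[OF \<alpha>(1)] by (simp add: Group.hom_mult[OF auto_hom[OF \<alpha>(1)]])
    finally show "descend G H h \<alpha> (a \<otimes>\<^bsub>H\<^esub> b) = descend G H h \<alpha> a \<otimes>\<^bsub>H\<^esub> descend G H h \<alpha> b"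
      using xy ap by simp
  qed
  show "descend G H h \<alpha> \<in> extensional (carrier H)" by (simp add: descend_def)
  have "descend G H h \<alpha> ` carrier H = h ` \<alpha> ` carrier G"
    unfolding surj[symmetric] image_image using ap by simp
  also have "\<dots> = carrier H" using auto_bij[OF \<alpha>(1)] surj by (simp add: bij_betw_def)
  finally show "bij_betw (descend G H h \<alpha>) (carrier H) (carrier H)"
    using fin by (simp add: bij_betw_def finite_surj_inj)
qed

lemma descend_compose:
  assumes surj: "h ` carrier G = carrier H" and fin: "finite (carrier H)"
    and \<alpha>: "\<alpha> \<in> auto G" "\<And>k. k \<in> kernel G H h \<Longrightarrow> \<alpha> k \<in> kernel G H h"
    and \<beta>: "\<beta> \<in> auto G" "\<And>k. k \<in> kernel G H h \<Longrightarrow> \<beta> k \<in> kernel G H h"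
  shows "descend G H h (compose (carrier G) \<alpha> \<beta>)
    = compose (carrier H) (descend G H h \<alpha>) (descend G H h \<beta>)"
proof (rule auto_eqI)
  have ap\<alpha>: "descend G H h \<alpha> (h x) = h (\<alpha> x)" if "x \<in> carrier G" for x
    using descend_apply[OF auto_hom[OF \<alpha>(1)] \<alpha>(2) that] .
  have ap\<beta>: "descend G H h \<beta> (h x) = h (\<beta> x)" if "x \<in> carrier G" for x
    using descend_apply[OF auto_hom[OF \<beta>(1)] \<beta>(2) that] .
  have c: "compose (carrier G) \<alpha> \<beta> \<in> auto G" using \<alpha> \<beta> G.compose_auto by blast
  have ck: "compose (carrier G) \<alpha> \<beta> k \<in> kernel G H h" if "k \<in> kernel G H h" for k
    using that \<alpha> \<beta> by (auto simp: compose_def kernel_def)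
  show "descend G H h (compose (carrier G) \<alpha> \<beta>) \<in> auto H"
    by (rule descend_auto[OF surj fin c ck])
  show "compose (carrier H) (descend G H h \<alpha>) (descend G H h \<beta>) \<in> auto H"
    by (intro H.compose_auto descend_auto[OF surj fin] \<alpha> \<beta>)
  fix a assume a: "a \<in> carrier H"
  then obtain x where x: "x \<in> carrier G" "a = h x" using surj by blast
  then show "descend G H h (compose (carrier G) \<alpha> \<beta>) a
      = compose (carrier H) (descend G H h \<alpha>) (descend G H h \<beta>) a"
    using a descend_apply[OF auto_hom[OF c] ck x(1)] ap\<alpha>[OF auto_closed[OF \<beta>(1) x(1)]] ap\<beta>[OF x(1)]
    by (simp only: compose_eq)
qed

lemma descend_funpow:
  assumes \<alpha>: "\<alpha> \<in> hom G G" "\<And>k. k \<in> kernel G H h \<Longrightarrow> \<alpha> k \<in> kernel G H h"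
    and x: "x \<in> carrier G"
  shows "(descend G H h \<alpha> ^^ i) (h x) = h ((\<alpha> ^^ i) x)"
  using descend_apply[OF \<alpha> G.hom_funpow_closed[OF \<alpha>(1) x]] by (induction i) auto

end

section \<open>Conjugation by normalizing elements\<close>

definition conj_on :: "('a, 'b) monoid_scheme \<Rightarrow> 'a set \<Rightarrow> 'a \<Rightarrow> 'a \<Rightarrow> 'a"
  where "conj_on S P g = (\<lambda>x\<in>P. g \<otimes>\<^bsub>S\<^esub> x \<otimes>\<^bsub>S\<^esub> inv\<^bsub>S\<^esub> g)"

lemma (in group) conj_on_auto:
  assumes P: "subgroup P G" "finite P" and g: "g \<in> carrier G" "\<And>x. x \<in> P \<Longrightarrow> g \<otimes> x \<otimes> inv g \<in> P"
  shows "conj_on G P g \<in> auto (G\<lparr>carrier := P\<rparr>)"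
proof (rule autoI)
  have Pc: "x \<in> carrier G" if "x \<in> P" for x using P(1) that subgroup.mem_carrier by metis
  show "conj_on G P g \<in> hom (G\<lparr>carrier := P\<rparr>) (G\<lparr>carrier := P\<rparr>)"
  proof (rule homI)
    fix x y assume "x \<in> carrier (G\<lparr>carrier := P\<rparr>)" "y \<in> carrier (G\<lparr>carrier := P\<rparr>)"
    then have xy: "x \<in> P" "y \<in> P" by auto
    then have "x \<otimes> y \<in> P" using P(1) subgroup.m_closed by metis
    then show "conj_on G P g (x \<otimes>\<^bsub>G\<lparr>carrier := P\<rparr>\<^esub> y)
        = conj_on G P g x \<otimes>\<^bsub>G\<lparr>carrier := P\<rparr>\<^esub> conj_on G P g y"
      using xy Pc g by (simp add: conj_on_def m_assoc) (simp flip: m_assoc)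
  qed (use g in \<open>simp add: conj_on_def\<close>)
  have "inj_on (conj_on G P g) P" using Pc g by (auto simp: inj_on_def conj_on_def)
  moreover have "conj_on G P g ` P \<subseteq> P" using g by (auto simp: conj_on_def)
  ultimately show "bij_betw (conj_on G P g) (carrier (G\<lparr>carrier := P\<rparr>)) (carrier (G\<lparr>carrier := P\<rparr>))"
    using P(2) by (simp add: bij_betw_def endo_inj_surj)
qed (simp add: conj_on_def)

lemma (in group) conj_on_mult:
  assumes P: "subgroup P G"
    and g: "g \<in> carrier G"
    and h: "h \<in> carrier G" "\<And>x. x \<in> P \<Longrightarrow> h \<otimes> x \<otimes> inv h \<in> P"
  shows "conj_on G P (g \<otimes> h) = compose P (conj_on G P g) (conj_on G P h)"
  using g h subgroup.mem_carrier[OF P]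
  by (auto simp: conj_on_def compose_def fun_eq_iff inv_mult_group m_assoc)

lemma (in group) conj_on_funpow:
  assumes P: "subgroup P G"
    and g: "g \<in> carrier G" "\<And>x. x \<in> P \<Longrightarrow> g \<otimes> x \<otimes> inv g \<in> P" and x: "x \<in> P"
  shows "(conj_on G P g ^^ i) x = g [^] i \<otimes> x \<otimes> inv (g [^] i)"
proof -
  have xc: "x \<in> carrier G" using x P subgroup.mem_carrier by metis
  have "(conj_on G P g ^^ i) x = g [^] i \<otimes> x \<otimes> inv (g [^] i) \<and> (conj_on G P g ^^ i) x \<in> P"
  proof (induction i)
    case (Suc i)
    have "g [^] Suc i = g \<otimes> g [^] i" using g(1) by (rule nat_pow_Suc2)
    then have "g [^] Suc i \<otimes> x \<otimes> inv (g [^] Suc i) = g \<otimes> (g [^] i \<otimes> x \<otimes> inv (g [^] i)) \<otimes> inv g"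
      using g(1) xc by (simp add: inv_mult_group m_assoc del: nat_pow_Suc)
    moreover have "conj_on G P g y = g \<otimes> y \<otimes> inv g" if "y \<in> P" for y
      using that by (simp add: conj_on_def)
    ultimately show ?case using Suc g(2)[of "(conj_on G P g ^^ i) x"]
      by (simp del: nat_pow_Suc) metis
  qed (use x xc in auto)
  then show ?thesis by blast
qed

section \<open>The normalizer and the automorphism group of a Sylow subgroup\<close>

lemma group_cyclic_power [simp]: "group (cyclic_power m n)"
  by (simp add: cyclic_power_def)

lemma carrier_cyclic_power:
  "m > 0 \<Longrightarrow> carrier (cyclic_power m n) = ({..<n} \<rightarrow>\<^sub>E {0..<int m})"
  by (simp add: cyclic_power_def carrier_integer_mod_group)

lemma mult_cyclic_power:
  "v \<otimes>\<^bsub>cyclic_power m n\<^esub> w = (\<lambda>i\<in>{..<n}. (v i + w i) mod int m)"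
  by (simp add: cyclic_power_def)

lemma one_cyclic_power: "\<one>\<^bsub>cyclic_power m n\<^esub> = (\<lambda>i\<in>{..<n}. 0)"
  by (simp add: cyclic_power_def)

lemma order_cyclic_power: "m > 0 \<Longrightarrow> order (cyclic_power m n) = m ^ n"
  by (simp add: order_def carrier_cyclic_power card_PiE)

lemma pow_cyclic_power:
  assumes "v \<in> carrier (cyclic_power m n)"
  shows "v [^]\<^bsub>cyclic_power m n\<^esub> m = \<one>\<^bsub>cyclic_power m n\<^esub>"
proof -
  have "v [^]\<^bsub>cyclic_power m n\<^esub> j = (\<lambda>i\<in>{..<n}. (int j * v i) mod int m)" for j :: nat
    by (induction j)
      (auto simp: one_cyclic_power mult_cyclic_power fun_eq_iff mod_simps algebra_simps)
  then show ?thesis by (simp add: one_cyclic_power fun_eq_iff)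
qed

text \<open>Conjugation is injective, so mapping a finite \<open>P\<close> into itself already means
  mapping it onto itself.\<close>

lemma (in group) mem_normalizer_iff:
  assumes "P \<subseteq> carrier G" "finite P"
  shows "g \<in> normalizer G P \<longleftrightarrow> g \<in> carrier G \<and> (\<forall>x\<in>P. g \<otimes> x \<otimes> inv g \<in> P)"
proof -
  have "g <# P #> inv g = P \<longleftrightarrow> (\<forall>x\<in>P. g \<otimes> x \<otimes> inv g \<in> P)" if g: "g \<in> carrier G"
  proof -
    have eq: "g <# P #> inv g = (\<lambda>x. g \<otimes> x \<otimes> inv g) ` P"
      by (auto simp: l_coset_def r_coset_def)
    have "inj_on (\<lambda>x. g \<otimes> x \<otimes> inv g) P"
      using g assms(1) by (auto simp: inj_on_def subset_iff)
    then show ?thesis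
      unfolding eq using endo_inj_surj[OF assms(2), of "\<lambda>x. g \<otimes> x \<otimes> inv g"] by blast
  qed
  then show ?thesis using assms(1) by (auto simp: normalizer_def stabilizer_def)
qed

text \<open>What the theorem needs to know about the homomorphism \<open>Aut(P) \<rightarrow> (C\<^bsub>p-1\<^esub>)\<^sup>n\<close>:
  together with \<open>C(P) \<le> P\<close> it yields all four claims formally.\<close>
definition diagonal_character ::
    "nat \<Rightarrow> nat \<Rightarrow> ('a, 'b) monoid_scheme \<Rightarrow> 'a set \<Rightarrow> (('a \<Rightarrow> 'a) \<Rightarrow> nat \<Rightarrow> int) \<Rightarrow> bool"
  where "diagonal_character p n S P \<theta> \<longleftrightarrow>
    \<theta> \<in> hom (AutoGroup (S\<lparr>carrier := P\<rparr>)) (cyclic_power (p - 1) n) \<and>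
    (\<forall>\<alpha>\<in>auto (S\<lparr>carrier := P\<rparr>). \<forall>q. prime q \<longrightarrow> q \<noteq> p \<longrightarrow> \<theta> \<alpha> = \<one>\<^bsub>cyclic_power (p - 1) n\<^esub> \<longrightarrow>
      (\<forall>x\<in>P. (\<alpha> ^^ q) x = x) \<longrightarrow> (\<forall>x\<in>P. \<alpha> x = x)) \<and>
    (\<forall>v\<in>carrier (cyclic_power (p - 1) n). \<exists>g\<in>carrier S.
      (\<forall>x\<in>P. g \<otimes>\<^bsub>S\<^esub> x \<otimes>\<^bsub>S\<^esub> inv\<^bsub>S\<^esub> g \<in> P) \<and> \<theta> (conj_on S P g) = v)"

section \<open>The structure of normalizer and automorphism group derived from a character\<close>

locale sylow_with_character = group S for S (structure) +
  fixes p n :: nat and P \<theta>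
  assumes prime_p: "prime p"
    and sylow: "sylow_subgroup p P S"
    and centralizer_le: "centralizer S P \<subseteq> P"
    and character: "diagonal_character p n S P \<theta>"
begin

abbreviation "PG \<equiv> S\<lparr>carrier := P\<rparr>"
abbreviation "N \<equiv> normalizer S P"
abbreviation "NG \<equiv> S\<lparr>carrier := N\<rparr>"
abbreviation "C \<equiv> cyclic_power (p - 1) n"
abbreviation "\<chi> \<equiv> \<lambda>g. \<theta> (conj_on S P g)"

lemma finS: "finite (carrier S)" and subP: "subgroup P S"
  and cardP: "card P = p ^ multiplicity p (order S)"
  using sylow by (auto simp: sylow_subgroup_def)

lemma Pc: "P \<subseteq> carrier S"
  using subP by (rule subgroup.subset)

lemma finP: "finite P"
  using Pc finS by (rule finite_subset)

lemma group_PG: "group PG"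
  using subP by (rule subgroup_imp_group)

lemma p_gt_1: "p > 1"
  using prime_p by (rule prime_gt_1_nat)

lemma mem_N: "g \<in> N \<longleftrightarrow> g \<in> carrier S \<and> (\<forall>x\<in>P. g \<otimes> x \<otimes> inv g \<in> P)"
  by (rule mem_normalizer_iff[OF Pc finP])

lemma subN: "subgroup N S"
  using Pc by (rule normalizer_imp_subgroup)

lemma group_NG: "group NG"
  using subN by (rule subgroup_imp_group)

lemma P_le_N: "P \<subseteq> N"
proof
  fix g assume g: "g \<in> P"
  then have "g \<otimes> x \<otimes> inv g \<in> P" if "x \<in> P" for x
    using that subgroup.m_closed[OF subP] subgroup.m_inv_closed[OF subP] by simp
  with g Pc show "g \<in> N" by (auto simp: mem_N)
qed

lemma conj_auto: "g \<in> N \<Longrightarrow> conj_on S P g \<in> auto PG"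
  using conj_on_auto[OF subP finP] by (simp add: mem_N)

lemma kernel_trivial:
  assumes "\<alpha> \<in> auto PG" "prime q" "q \<noteq> p" "\<theta> \<alpha> = \<one>\<^bsub>C\<^esub>" "\<And>x. x \<in> P \<Longrightarrow> (\<alpha> ^^ q) x = x" "x \<in> P"
  shows "\<alpha> x = x"
  using character assms unfolding diagonal_character_def by blast

lemma surj: "v \<in> carrier C \<Longrightarrow> \<exists>g\<in>N. \<chi> g = v"
  using character unfolding diagonal_character_def by (metis mem_N)

sublocale \<theta>: group_hom "AutoGroup PG" C \<theta>
  using character group.AutoGroup[OF group_PG]
  by (simp add: diagonal_character_def group_hom_def group_hom_axioms_def)

lemma \<theta>_surj: "\<theta> ` carrier (AutoGroup PG) = carrier C"
proof
  show "\<theta> ` carrier (AutoGroup PG) \<subseteq> carrier C" using \<theta>.hom_closed by blast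
  show "carrier C \<subseteq> \<theta> ` carrier (AutoGroup PG)"
  proof
    fix v assume "v \<in> carrier C"
    then obtain g where "g \<in> N" "\<chi> g = v" using surj by blast
    then show "v \<in> \<theta> ` carrier (AutoGroup PG)" using conj_auto by force
  qed
qed

lemma fin_auto: "finite (auto PG)"
  using finP by (simp add: finite_auto)

text \<open>The second clause of \<open>diagonal_character\<close> excludes elements of prime order
  other than \<open>p\<close> from the kernel, so the prime power criterion applies.\<close>

lemma order_kernel: "\<exists>k. card (kernel (AutoGroup PG) C \<theta>) = p ^ k"
proof -
  let ?K = "kernel (AutoGroup PG) C \<theta>"
  interpret K: group "AutoGroup PG\<lparr>carrier := ?K\<rparr>"
    using \<theta>.subgroup_kernel \<theta>.G.subgroup_imp_group by blast
  have fin: "finite ?K" using fin_auto by (simp add: kernel_def)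
  have "\<exists>k. order (AutoGroup PG\<lparr>carrier := ?K\<rparr>) = p ^ k"
  proof (rule K.order_eq_prime_power[OF _ prime_p])
    fix q \<alpha>
    assume q: "prime q" "q \<noteq> p" and \<alpha>: "\<alpha> \<in> carrier (AutoGroup PG\<lparr>carrier := ?K\<rparr>)"
      and pw: "\<alpha> [^]\<^bsub>AutoGroup PG\<lparr>carrier := ?K\<rparr>\<^esub> q = \<one>\<^bsub>AutoGroup PG\<lparr>carrier := ?K\<rparr>\<^esub>"
    have \<alpha>': "\<alpha> \<in> auto PG" "\<theta> \<alpha> = \<one>\<^bsub>C\<^esub>" using \<alpha> by (auto simp: kernel_def)
    have "\<alpha> [^]\<^bsub>AutoGroup PG\<^esub> q = \<one>\<^bsub>AutoGroup PG\<^esub>"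
      using pw \<theta>.G.nat_pow_consistent[of \<alpha> q ?K] by simp
    then have "(\<alpha> ^^ q) x = x" if "x \<in> P" for x
      using group.pow_AutoGroup[OF group_PG \<alpha>'(1), of x q] that by (simp add: one_AutoGroup)
    then have "\<alpha> x = x" if "x \<in> P" for x
      using kernel_trivial[OF \<alpha>'(1) q \<alpha>'(2) _ that] by blast
    then have "\<alpha> = \<one>\<^bsub>AutoGroup PG\<^esub>"
      using \<theta>.G.one_closed by (intro auto_eqI[OF \<alpha>'(1)]) (auto simp: one_AutoGroup)
    then show "\<alpha> = \<one>\<^bsub>AutoGroup PG\<lparr>carrier := ?K\<rparr>\<^esub>" by simp
  qed (use fin in simp)
  then show ?thesis by (simp add: order_def)
qed

lemma order_auto: "order (AutoGroup PG) = (p - 1) ^ n * card (kernel (AutoGroup PG) C \<theta>)"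
  using \<theta>.card_image_times_kernel \<theta>_surj fin_auto order_cyclic_power[of "p - 1" n] p_gt_1
  by (simp add: order_def)

text \<open>The index of the kernel, a power of \<open>p - 1\<close>, is prime to \<open>p\<close>,
  so the kernel carries the full \<open>p\<close>-part of the order.\<close>

lemma kernel_sylow: "sylow_subgroup p (kernel (AutoGroup PG) C \<theta>) (AutoGroup PG)"
proof -
  obtain k where k: "card (kernel (AutoGroup PG) C \<theta>) = p ^ k" using order_kernel by blast
  have "\<not> p dvd p - 1" using p_gt_1 by (auto dest: dvd_imp_le)
  then have "\<not> p dvd (p - 1) ^ n" using prime_p prime_dvd_power by blast
  then have "multiplicity p (order (AutoGroup PG)) = k"
    unfolding order_auto k using prime_p p_gt_1
    by (subst prime_elem_multiplicity_mult_distrib) (auto simp: not_dvd_imp_multiplicity_0)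
  then show ?thesis using k \<theta>.subgroup_kernel fin_auto by (simp add: sylow_subgroup_def)
qed

lemma \<chi>_hom: "group_hom NG C \<chi>"
proof -
  have "\<chi> \<in> hom NG C"
  proof (rule homI)
    fix g assume "g \<in> carrier NG"
    then show "\<chi> g \<in> carrier C" using conj_auto \<theta>.hom_closed by simp
  next
    fix g h assume "g \<in> carrier NG" "h \<in> carrier NG"
    then have gh: "g \<in> N" "h \<in> N" by auto
    then have "conj_on S P (g \<otimes> h) = conj_on S P g \<otimes>\<^bsub>AutoGroup PG\<^esub> conj_on S P h"
      using conj_auto conj_on_mult[OF subP] by (simp add: mult_AutoGroup mem_N)
    then show "\<chi> (g \<otimes>\<^bsub>NG\<^esub> h) = \<chi> g \<otimes>\<^bsub>C\<^esub> \<chi> h"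
      using gh conj_auto \<theta>.hom_mult by simp
  qed
  then show ?thesis using group_NG by (simp add: group_hom_def group_hom_axioms_def)
qed

lemma \<chi>_surj: "\<chi> ` carrier NG = carrier C"
  using surj conj_auto \<theta>.hom_closed by force

lemma \<chi>_kernel: "kernel NG C \<chi> = P"
proof -
  interpret \<chi>: group_hom NG C \<chi> by (rule \<chi>_hom)
  let ?L = "kernel NG C \<chi>"
  have subL: "subgroup ?L S"
    using \<chi>.subgroup_kernel subN incl_subgroup by blast
  interpret L: group "S\<lparr>carrier := ?L\<rparr>" using subL subgroup_imp_group by blast
  have finL: "finite ?L" using subgroup.subset[OF subL] finS by (rule finite_subset)
  have "\<exists>k. order (S\<lparr>carrier := ?L\<rparr>) = p ^ k"
  proof (rule L.order_eq_prime_power[OF _ prime_p])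
    fix q g assume q: "prime q" "q \<noteq> p" and "g \<in> carrier (S\<lparr>carrier := ?L\<rparr>)"
      and "g [^]\<^bsub>S\<lparr>carrier := ?L\<rparr>\<^esub> q = \<one>\<^bsub>S\<lparr>carrier := ?L\<rparr>\<^esub>"
    then have g: "g \<in> N" "\<chi> g = \<one>\<^bsub>C\<^esub>" and pw: "g [^] q = \<one>"
      using nat_pow_consistent[of g q ?L] by (auto simp: kernel_def)
    have gS: "g \<in> carrier S" using g mem_N by blast
    have fx: "conj_on S P g x = x" if x: "x \<in> P" for x
    proof (rule kernel_trivial[OF conj_auto[OF g(1)] q g(2) _ x])
      fix y assume "y \<in> P"
      then show "(conj_on S P g ^^ q) y = y"
        using conj_on_funpow[OF subP gS _ \<open>y \<in> P\<close>, of q] g Pc by (auto simp: mem_N pw)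
    qed
    \<comment> \<open>Conjugation by \<open>g\<close> is trivial on \<open>P\<close>, so
      \<open>g\<close> centralizes \<open>P\<close> and therefore lies in it; its order then divides
      both \<open>q\<close> and a power of \<open>p\<close>.\<close>
    have "g \<otimes> x = x \<otimes> g" if x: "x \<in> P" for x
    proof -
      have "x = g \<otimes> x \<otimes> inv g" using fx[OF x] x by (simp add: conj_on_def)
      then show ?thesis using inv_solve_right[of x "g \<otimes> x" g] gS x Pc by auto
    qed
    then have "g \<in> P" using centralizer_le gS by (auto simp: centralizer_def)
    then have "g [^] card P = \<one>"
      using group.pow_order_eq_1[OF group_PG, of g] nat_pow_consistent[of g "card P" P]
      by (simp add: order_def)
    moreover have "coprime q (card P)"
      using q prime_p by (simp add: cardP primes_coprime)
    ultimately show "g = \<one>\<^bsub>S\<lparr>carrier := ?L\<rparr>\<^esub>" using pow_coprime_eq_one[OF gS pw] by simp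
  qed (use finL in simp)
  then obtain k where k: "card ?L = p ^ k" by (auto simp: order_def)
  \<comment> \<open>The value of \<chi> on an element of \<open>P\<close> is annihilated by
    \<open>card P\<close>, a power of \<open>p\<close>, and by \<open>p - 1\<close>, which are
    coprime.\<close>
  have "P \<subseteq> ?L"
  proof
    fix g assume g: "g \<in> P"
    then have gN: "g \<in> N" using P_le_N by blast
    have "g [^]\<^bsub>NG\<^esub> card P = \<one>\<^bsub>NG\<^esub>"
      using group.pow_order_eq_1[OF group_PG, of g] g nat_pow_consistent[of g "card P" P]
        nat_pow_consistent[of g "card P" N]
      by (simp add: order_def)
    then have "\<chi> g [^]\<^bsub>C\<^esub> card P = \<one>\<^bsub>C\<^esub>"
      using \<chi>.hom_nat_pow[of g "card P"] gN \<chi>.hom_one by simp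
    moreover have "\<chi> g [^]\<^bsub>C\<^esub> (p - 1) = \<one>\<^bsub>C\<^esub>"
      using pow_cyclic_power \<chi>.hom_closed gN by simp
    moreover have "coprime (card P) (p - 1)"
    proof -
      have "coprime p (p - 1)" using p_gt_1 coprime_diff_one_right_nat[of p] by linarith
      then show ?thesis by (simp add: cardP)
    qed
    ultimately have "\<chi> g = \<one>\<^bsub>C\<^esub>"
      using group.pow_coprime_eq_one[OF group_cyclic_power] \<chi>.hom_closed[of g] gN by simp
    with gN show "g \<in> ?L" by (simp add: kernel_def)
  qed
  \<comment> \<open>A \<open>p\<close>-subgroup cannot be larger than a Sylow subgroup, so the
    inclusion is an equality.\<close>
  moreover have "card ?L \<le> card P"
  proof -
    have "p ^ k dvd order S" using lagrange[OF subL] k by (metis dvd_triv_right)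
    moreover have "order S \<noteq> 0" using finS order_gt_0_iff_finite by simp
    ultimately have "k \<le> multiplicity p (order S)"
      using p_gt_1 by (intro multiplicity_geI) auto
    then show ?thesis unfolding k cardP using p_gt_1 by (simp add: power_increasing)
  qed
  ultimately show ?thesis using finL card_seteq by blast
qed

theorem structure_of_normalizer_and_automorphisms:
  "centralizer S P = center PG"
  "NG Mod P \<cong> C"
  "\<exists>Q. sylow_subgroup p Q (AutoGroup PG) \<and> Q \<lhd> AutoGroup PG \<and> AutoGroup PG Mod Q \<cong> C"
  "p = 2 \<Longrightarrow> finite_p_group 2 (AutoGroup PG) \<and> N = P"
proof -
  show "centralizer S P = center PG"
    using centralizer_le Pc by (auto simp: centralizer_def center_def)
  show "NG Mod P \<cong> C"
    using group_hom.FactGroup_iso[OF \<chi>_hom \<chi>_surj] by (simp only: \<chi>_kernel)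
  show "\<exists>Q. sylow_subgroup p Q (AutoGroup PG) \<and> Q \<lhd> AutoGroup PG \<and> AutoGroup PG Mod Q \<cong> C"
    using kernel_sylow \<theta>.normal_kernel \<theta>.FactGroup_iso[OF \<theta>_surj] by blast
  assume 2: "p = 2"
  have "finite_p_group 2 (AutoGroup PG)"
    using order_auto order_kernel fin_auto 2 \<theta>.G.group_axioms
    by (auto simp: finite_p_group_def)
  moreover have "N = P"
  proof -
    \<comment> \<open>For \<open>p = 2\<close> the target is a power of the group of order 1, so all
      of \<open>N\<close> lies in the kernel of \<chi>, which is \<open>P\<close>.\<close>
    have "N \<subseteq> kernel NG C \<chi>"
    proof
      fix g assume g: "g \<in> N"
      then have "\<chi> g \<in> carrier C" using conj_auto \<theta>.hom_closed by simp
      moreover have "{0..<1::int} = {0}" by auto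
      then have "carrier C = {\<one>\<^bsub>C\<^esub>}"
        using 2 by (simp add: carrier_cyclic_power one_cyclic_power PiE_eq_singleton)
      ultimately have "\<chi> g = \<one>\<^bsub>C\<^esub>" by simp
      with g show "g \<in> kernel NG C \<chi>" by (simp add: kernel_def)
    qed
    then show ?thesis using P_le_N \<chi>_kernel by blast
  qed
  ultimately show "finite_p_group 2 (AutoGroup PG) \<and> N = P" by blast
qed

end

section \<open>Transport along group isomorphisms\<close>

text \<open>Automorphisms of the image are pulled back along \<psi> before the character is applied.
  This carries a character from the model on words to an arbitrary Sylow subgroup.\<close>

lemma diagonal_character_iso:
  assumes G: "group S" "group T" and \<psi>: "\<psi> \<in> iso S T" and P: "subgroup P S"
    and \<theta>: "diagonal_character p n S P \<theta>"
  shows "\<exists>\<theta>'. diagonal_character p n T (\<psi> ` P) \<theta>'"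
proof -
  interpret S: group S by fact
  interpret \<psi>: group_hom S T \<psi>
    using G \<psi> by (simp add: group_hom_def group_hom_axioms_def iso_def)
  have Pc: "P \<subseteq> carrier S" using P by (rule subgroup.subset)
  have inj: "inj_on \<psi> (carrier S)" using \<psi> by (simp add: iso_def bij_betw_def)
  define \<rho> where "\<rho> = inv_into P \<psi>"
  have \<rho>[simp]: "\<rho> (\<psi> x) = x" if "x \<in> P" for x
    using that Pc inj by (simp add: \<rho>_def inj_on_subset[OF inj Pc])
  define pull where "pull \<alpha> = (\<lambda>x\<in>P. \<rho> (\<alpha> (\<psi> x)))" for \<alpha>
  let ?P = "S\<lparr>carrier := P\<rparr>" and ?Q = "T\<lparr>carrier := \<psi> ` P\<rparr>" and ?C = "cyclic_power (p - 1) n"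
  have mult: "\<psi> (x \<otimes>\<^bsub>S\<^esub> y) = \<psi> x \<otimes>\<^bsub>T\<^esub> \<psi> y" if "x \<in> P" "y \<in> P" for x y
    using that Pc by (intro \<psi>.hom_mult) auto
  have grP: "group ?P" using P by (rule S.subgroup_imp_group)
  have grQ: "group ?Q"
    using \<psi>.subgroup_img_is_subgroup[OF P] by (rule \<psi>.H.subgroup_imp_group)
  have img: "\<exists>y\<in>P. \<alpha> (\<psi> x) = \<psi> y" if "\<alpha> \<in> auto ?Q" "x \<in> P" for \<alpha> x
    using auto_closed[OF that(1), of "\<psi> x"] that(2) by auto
  have pull_eq: "\<psi> (pull \<alpha> x) = \<alpha> (\<psi> x)" "pull \<alpha> x \<in> P" if "\<alpha> \<in> auto ?Q" "x \<in> P" for \<alpha> x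
    using img[OF that] that(2) by (auto simp: pull_def)
  have injP: "x = y" if "\<psi> x = \<psi> y" "x \<in> P" "y \<in> P" for x y
    using inj_onD[OF inj that(1)] that Pc by blast
  have pull_auto: "pull \<alpha> \<in> auto ?P" if \<alpha>: "\<alpha> \<in> auto ?Q" for \<alpha>
  proof (rule autoI)
    show "pull \<alpha> \<in> hom ?P ?P"
    proof (rule homI)
      fix x y assume "x \<in> carrier ?P" "y \<in> carrier ?P"
      then have xy: "x \<in> P" "y \<in> P" "x \<otimes>\<^bsub>S\<^esub> y \<in> P" using subgroup.m_closed[OF P] by auto
      have "\<psi> (pull \<alpha> (x \<otimes>\<^bsub>S\<^esub> y)) = \<alpha> (\<psi> x \<otimes>\<^bsub>T\<^esub> \<psi> y)"
        using pull_eq[OF \<alpha>] xy mult by simp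
      also have "\<dots> = \<alpha> (\<psi> x) \<otimes>\<^bsub>T\<^esub> \<alpha> (\<psi> y)"
        using Group.hom_mult[OF auto_hom[OF \<alpha>], of "\<psi> x" "\<psi> y"] xy by simp
      also have "\<dots> = \<psi> (pull \<alpha> x \<otimes>\<^bsub>S\<^esub> pull \<alpha> y)"
        using pull_eq[OF \<alpha>] xy mult by simp
      finally have "pull \<alpha> (x \<otimes>\<^bsub>S\<^esub> y) = pull \<alpha> x \<otimes>\<^bsub>S\<^esub> pull \<alpha> y"
        using injP pull_eq[OF \<alpha>] xy subgroup.m_closed[OF P] by metis
      then show "pull \<alpha> (x \<otimes>\<^bsub>?P\<^esub> y) = pull \<alpha> x \<otimes>\<^bsub>?P\<^esub> pull \<alpha> y" by simp
    qed (use pull_eq[OF \<alpha>] in simp)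
    show "bij_betw (pull \<alpha>) (carrier ?P) (carrier ?P)"
    proof (rule bij_betw_imageI)
      have "x = y" if "x \<in> P" "y \<in> P" "pull \<alpha> x = pull \<alpha> y" for x y
      proof -
        have "\<alpha> (\<psi> x) = \<alpha> (\<psi> y)" using pull_eq[OF \<alpha>] that by metis
        then have "\<psi> x = \<psi> y" using auto_bij[OF \<alpha>] that by (auto simp: bij_betw_def inj_on_def)
        then show ?thesis using injP that by blast
      qed
      then show "inj_on (pull \<alpha>) (carrier ?P)" by (simp add: inj_on_def)
      have "y \<in> pull \<alpha> ` P" if y: "y \<in> P" for y
      proof -
        have "\<psi> y \<in> \<alpha> ` \<psi> ` P" using auto_bij[OF \<alpha>] y by (simp add: bij_betw_def)
        then obtain x where "x \<in> P" "\<psi> y = \<alpha> (\<psi> x)" by blast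
        then have "y = pull \<alpha> x" using injP[of y "pull \<alpha> x"] pull_eq[OF \<alpha>] y by simp
        with \<open>x \<in> P\<close> show ?thesis by blast
      qed
      then show "pull \<alpha> ` carrier ?P = carrier ?P" using pull_eq[OF \<alpha>] by auto
    qed
  qed (simp add: pull_def)
  have pull_compose: "pull (compose (\<psi> ` P) \<alpha> \<beta>) = compose P (pull \<alpha>) (pull \<beta>)"
    if "\<alpha> \<in> auto ?Q" "\<beta> \<in> auto ?Q" for \<alpha> \<beta>
    using pull_eq[OF that(2)] by (auto simp: pull_def compose_def fun_eq_iff)
  have pull_funpow: "\<psi> ((pull \<alpha> ^^ i) x) = (\<alpha> ^^ i) (\<psi> x) \<and> (pull \<alpha> ^^ i) x \<in> P"
    if "\<alpha> \<in> auto ?Q" "x \<in> P" for \<alpha> i x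
    by (induction i) (use that pull_eq[OF that(1)] in auto)
  have "diagonal_character p n T (\<psi> ` P) (\<lambda>\<alpha>. \<theta> (pull \<alpha>))"
    unfolding diagonal_character_def
  proof (intro conjI ballI allI impI)
    show "(\<lambda>\<alpha>. \<theta> (pull \<alpha>)) \<in> hom (AutoGroup ?Q) ?C"
    proof (rule homI)
      have \<theta>h: "\<theta> \<in> hom (AutoGroup ?P) ?C" using \<theta> by (simp add: diagonal_character_def)
      fix \<alpha> \<beta> assume ab: "\<alpha> \<in> carrier (AutoGroup ?Q)" "\<beta> \<in> carrier (AutoGroup ?Q)"
      then show "\<theta> (pull \<alpha>) \<in> carrier ?C" using \<theta>h pull_auto by (simp add: hom_def Pi_iff)
      show "\<theta> (pull (\<alpha> \<otimes>\<^bsub>AutoGroup ?Q\<^esub> \<beta>)) = \<theta> (pull \<alpha>) \<otimes>\<^bsub>?C\<^esub> \<theta> (pull \<beta>)"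
        using Group.hom_mult[OF \<theta>h, of "pull \<alpha>" "pull \<beta>"] ab pull_auto
        by (simp add: mult_AutoGroup pull_compose)
    qed
  next
    fix \<alpha> q y
    assume \<alpha>: "\<alpha> \<in> auto ?Q" and q: "prime q" "q \<noteq> p" and one: "\<theta> (pull \<alpha>) = \<one>\<^bsub>?C\<^esub>"
      and per: "\<forall>x\<in>\<psi> ` P. (\<alpha> ^^ q) x = x" and "y \<in> \<psi> ` P"
    then obtain x where x: "x \<in> P" "y = \<psi> x" by blast
    have "(pull \<alpha> ^^ q) z = z" if "z \<in> P" for z
      using pull_funpow[OF \<alpha> that, of q] per that injP by auto
    then have "pull \<alpha> x = x"
      using \<theta> q one pull_auto[OF \<alpha>] x unfolding diagonal_character_def by blast
    then show "\<alpha> y = y" using pull_eq(1)[OF \<alpha> x(1)] x by simp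
  next
    fix v assume "v \<in> carrier ?C"
    then obtain g where g: "g \<in> carrier S" "\<And>x. x \<in> P \<Longrightarrow> g \<otimes>\<^bsub>S\<^esub> x \<otimes>\<^bsub>S\<^esub> inv\<^bsub>S\<^esub> g \<in> P"
      "\<theta> (conj_on S P g) = v"
      using \<theta> unfolding diagonal_character_def by blast
    have c: "\<psi> g \<otimes>\<^bsub>T\<^esub> \<psi> x \<otimes>\<^bsub>T\<^esub> inv\<^bsub>T\<^esub> (\<psi> g) = \<psi> (g \<otimes>\<^bsub>S\<^esub> x \<otimes>\<^bsub>S\<^esub> inv\<^bsub>S\<^esub> g)" if "x \<in> P" for x
      using g(1) that Pc by (auto simp: subset_iff)
    \<comment> \<open>Conjugation by the image of \<open>g\<close> pulls back to conjugation by
      \<open>g\<close>, so every vector keeps a witness.\<close>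
    have "pull (conj_on T (\<psi> ` P) (\<psi> g)) = conj_on S P g"
      using c g by (auto simp: pull_def conj_on_def fun_eq_iff)
    then show "\<exists>g\<in>carrier T. (\<forall>x\<in>\<psi> ` P. g \<otimes>\<^bsub>T\<^esub> x \<otimes>\<^bsub>T\<^esub> inv\<^bsub>T\<^esub> g \<in> \<psi> ` P)
        \<and> \<theta> (pull (conj_on T (\<psi> ` P) g)) = v"
      using g c by (intro bexI[of _ "\<psi> g"]) auto
  qed
  then show ?thesis by blast
qed

lemma centralizer_iso_le:
  assumes \<psi>: "\<psi> \<in> iso S T" and P: "P \<subseteq> carrier S" and C: "centralizer S P \<subseteq> P"
    and G: "group S"
  shows "centralizer T (\<psi> ` P) \<subseteq> \<psi> ` P"
proof
  fix h assume "h \<in> centralizer T (\<psi> ` P)"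
  then have h: "h \<in> carrier T" "\<And>x. x \<in> P \<Longrightarrow> h \<otimes>\<^bsub>T\<^esub> \<psi> x = \<psi> x \<otimes>\<^bsub>T\<^esub> h"
    by (auto simp: centralizer_def)
  obtain g where g: "g \<in> carrier S" "h = \<psi> g"
    using \<psi> h(1) by (auto simp: iso_def bij_betw_def)
  have "g \<otimes>\<^bsub>S\<^esub> x = x \<otimes>\<^bsub>S\<^esub> g" if x: "x \<in> P" for x
  proof -
    have xS: "x \<in> carrier S" using x P by blast
    have "\<psi> (g \<otimes>\<^bsub>S\<^esub> x) = \<psi> (x \<otimes>\<^bsub>S\<^esub> g)"
      using h(2)[OF x] g xS \<psi> by (simp add: iso_def hom_def)
    moreover have "g \<otimes>\<^bsub>S\<^esub> x \<in> carrier S" "x \<otimes>\<^bsub>S\<^esub> g \<in> carrier S"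
      using g xS monoid.m_closed[OF group.is_monoid[OF G]] by auto
    ultimately show ?thesis using \<psi> by (auto simp: iso_def bij_betw_def dest: inj_onD)
  qed
  then have "g \<in> P" using C g by (auto simp: centralizer_def)
  with g show "h \<in> \<psi> ` P" by blast
qed

section \<open>Symmetric groups\<close>

text \<open>The wreath product permutes words, so the set of points is arbitrary;
  \<open>sym_group m\<close> is the case \<open>{1..m}\<close>.\<close>

definition Sym :: "'a set \<Rightarrow> ('a \<Rightarrow> 'a) monoid"
  where "Sym S = \<lparr>carrier = {f. f permutes S}, mult = (\<circ>), one = id\<rparr>"

lemma sym_group_eq_Sym: "sym_group m = Sym {1..m}"
  by (simp add: sym_group_def Sym_def)

lemma carrier_Sym [simp]: "carrier (Sym S) = {f. f permutes S}"
  and mult_Sym [simp]: "f \<otimes>\<^bsub>Sym S\<^esub> g = f \<circ> g"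
  and one_Sym [simp]: "\<one>\<^bsub>Sym S\<^esub> = id"
  by (simp_all add: Sym_def)

lemma group_Sym [simp]: "group (Sym S)"
proof (rule groupI)
  fix f assume "f \<in> carrier (Sym S)"
  then show "\<exists>g\<in>carrier (Sym S). g \<otimes>\<^bsub>Sym S\<^esub> f = \<one>\<^bsub>Sym S\<^esub>"
    using permutes_inv[of f S] permutes_inv_o(2)[of f S] by (intro bexI[of _ "inv' f"]) auto
qed (auto simp: permutes_compose permutes_id comp_assoc)

lemma finite_Sym: "finite S \<Longrightarrow> finite (carrier (Sym S))"
  by (simp add: finite_permutations)

lemma inv_Sym:
  assumes "g permutes S"
  shows "inv\<^bsub>Sym S\<^esub> g = inv' g"
  using assms permutes_inv[OF assms] permutes_inv_o(2)[OF assms]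
  by (intro group.inv_equality[OF group_Sym]) auto

lemma Sym_iso:
  assumes \<phi>: "bij_betw \<phi> A B"
  shows "(\<lambda>f y. if y \<in> B then \<phi> (f (inv_into A \<phi> y)) else y) \<in> iso (Sym A) (Sym B)"
    (is "?\<psi> \<in> _")
proof (rule isoI)
  have bij: "bij_betw ?\<psi> {f. f permutes A} {f. f permutes B}"
    using bij_betw_permutations[OF \<phi>] .
  then show "bij_betw ?\<psi> (carrier (Sym A)) (carrier (Sym B))" by simp
  show "?\<psi> \<in> hom (Sym A) (Sym B)"
  proof (rule homI)
    fix f assume "f \<in> carrier (Sym A)"
    then show "?\<psi> f \<in> carrier (Sym B)" using bij by (auto simp: bij_betw_def)
  next
    fix f g assume "f \<in> carrier (Sym A)" "g \<in> carrier (Sym A)"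
    then have fg: "f permutes A" "g permutes A" by auto
    have "?\<psi> (f \<circ> g) y = (?\<psi> f \<circ> ?\<psi> g) y" for y
    proof (cases "y \<in> B")
      case True
      then have "inv_into A \<phi> y \<in> A" using \<phi> by (auto simp: bij_betw_def inv_into_into)
      then have "g (inv_into A \<phi> y) \<in> A" using permutes_in_image[OF fg(2)] by blast
      then have "\<phi> (g (inv_into A \<phi> y)) \<in> B"
        "inv_into A \<phi> (\<phi> (g (inv_into A \<phi> y))) = g (inv_into A \<phi> y)"
        using \<phi> by (auto simp: bij_betw_def)
      with True show ?thesis by simp
    qed simp
    then show "?\<psi> (f \<otimes>\<^bsub>Sym A\<^esub> g) = ?\<psi> f \<otimes>\<^bsub>Sym B\<^esub> ?\<psi> g" unfolding mult_Sym by blast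
  qed
qed

section \<open>The iterated wreath product\<close>

locale sylow_tower =
  fixes p :: nat
  assumes prime_p: "prime p"
begin

lemma p_gt_1: "p > 1"
  using prime_p by (rule prime_gt_1_nat)

section \<open>Words over the residues modulo \<open>p\<close> and one wreath product step\<close>

definition pts :: "nat \<Rightarrow> int list set"
  where "pts n = {xs. set xs \<subseteq> {0..<int p} \<and> length xs = n}"

lemma pts_0: "pts 0 = {[]}"
  by (auto simp: pts_def)

lemma Cons_pts [simp]: "z # x \<in> pts (Suc n) \<longleftrightarrow> 0 \<le> z \<and> z < int p \<and> x \<in> pts n"
  by (auto simp: pts_def)

lemma pts_SucE:
  assumes "l \<in> pts (Suc n)"
  obtains z x where "l = z # x" "0 \<le> z" "z < int p" "x \<in> pts n"
  using assms by (cases l) (auto simp: pts_def)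

lemma finite_pts [simp]: "finite (pts n)"
  by (simp add: pts_def finite_lists_length_eq)

lemma card_pts: "card (pts n) = p ^ n"
  by (simp add: pts_def card_lists_length_eq)

lemma mod_pts [simp]: "0 \<le> z mod int p" "z mod int p < int p"
  using p_gt_1 by simp_all

text \<open>The newest coordinate of a point is its head, so that \<open>tl\<close> is the projection to the previous
  level of the tower. Values of \<open>f\<close> only matter modulo \<open>p\<close>.\<close>
definition wr :: "nat \<Rightarrow> (int list \<Rightarrow> int) \<Rightarrow> (int list \<Rightarrow> int list) \<Rightarrow> int list \<Rightarrow> int list"
  where "wr n f g l = (if l \<in> pts (Suc n) then ((hd l + f (tl l)) mod int p) # g (tl l) else l)"

lemma wr_Cons: "0 \<le> z \<Longrightarrow> z < int p \<Longrightarrow> x \<in> pts n \<Longrightarrow> wr n f g (z # x) = ((z + f x) mod int p) # g x"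
  by (simp add: wr_def)

lemma wr_outside: "l \<notin> pts (Suc n) \<Longrightarrow> wr n f g l = l"
  by (simp add: wr_def)

lemma wr_eqI:
  assumes "\<And>x. x \<in> pts n \<Longrightarrow> f x mod int p = f' x mod int p" "\<And>x. x \<in> pts n \<Longrightarrow> g x = g' x"
  shows "wr n f g = wr n f' g'"
proof
  fix l show "wr n f g l = wr n f' g' l"
  proof (cases "l \<in> pts (Suc n)")
    case True
    then obtain z x where "l = z # x" "0 \<le> z" "z < int p" "x \<in> pts n" by (rule pts_SucE)
    then show ?thesis using assms by (simp add: wr_Cons) (metis mod_add_right_eq)
  qed (simp add: wr_outside)
qed

lemma wr_eqD:
  assumes "wr n f g = wr n f' g'" "x \<in> pts n"
  shows "f x mod int p = f' x mod int p" "g x = g' x"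
proof -
  have "wr n f g (0 # x) = wr n f' g' (0 # x)" using assms by simp
  then show "f x mod int p = f' x mod int p" "g x = g' x"
    using assms(2) p_gt_1 by (simp_all add: wr_Cons)
qed

lemma wr_comp:
  assumes "g' permutes pts n"
  shows "wr n f g \<circ> wr n f' g' = wr n (\<lambda>x. f' x + f (g' x)) (g \<circ> g')"
proof
  fix l show "(wr n f g \<circ> wr n f' g') l = wr n (\<lambda>x. f' x + f (g' x)) (g \<circ> g') l"
  proof (cases "l \<in> pts (Suc n)")
    case True
    then obtain z x where "l = z # x" "0 \<le> z" "z < int p" "x \<in> pts n" by (rule pts_SucE)
    moreover from this have "g' x \<in> pts n" using assms permutes_in_image by metis
    ultimately show ?thesis by (simp add: wr_Cons mod_simps add.assoc)
  qed (simp add: wr_outside)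
qed

lemma wr_0_id: "wr n (\<lambda>_. 0) id = id"
proof
  fix l show "wr n (\<lambda>_. 0) id l = id l"
  proof (cases "l \<in> pts (Suc n)")
    case True
    then show ?thesis by (elim pts_SucE) (simp add: wr_Cons)
  qed (simp add: wr_outside)
qed

lemma wr_permutes:
  assumes g: "g permutes pts n"
  shows "wr n f g permutes pts (Suc n)"
proof (rule bij_imp_permutes)
  \<comment> \<open>The inverse dictated by \<open>wr_comp\<close>: the shift has to be undone at
    the tail on which \<open>g\<close> acted.\<close>
  let ?h = "wr n (\<lambda>x. - f (inv' g x)) (inv' g)"
  have ig: "inv' g permutes pts n" using g by (rule permutes_inv)
  have "wr n f g \<circ> ?h = id" "?h \<circ> wr n f g = id"
    using g by (simp_all add: wr_comp[OF ig] wr_comp[OF g] permutes_inverses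
        wr_0_id permutes_inv_o[OF g])
  then show "bij_betw (wr n f g) (pts (Suc n)) (pts (Suc n))"
  proof (intro bij_betwI[where g = ?h])
    show "wr n f g \<in> pts (Suc n) \<rightarrow> pts (Suc n)" "?h \<in> pts (Suc n) \<rightarrow> pts (Suc n)"
      using permutes_in_image[OF g] permutes_in_image[OF ig]
      by (auto elim!: pts_SucE simp: wr_Cons)
  qed (auto simp: fun_eq_iff)
qed (simp add: wr_outside)

lemma wr_eq_iff:
  assumes "g permutes pts n" "g' permutes pts n"
  shows "wr n f g = wr n f' g' \<longleftrightarrow> (\<forall>x\<in>pts n. f x mod int p = f' x mod int p) \<and> g = g'"
proof
  assume eq: "wr n f g = wr n f' g'"
  have "g x = g' x" for x
    using wr_eqD(2)[OF eq] permutes_not_in[OF assms(1)] permutes_not_in[OF assms(2)]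
    by (cases "x \<in> pts n") auto
  then show "(\<forall>x\<in>pts n. f x mod int p = f' x mod int p) \<and> g = g'"
    using wr_eqD(1)[OF eq] by auto
qed (auto intro: wr_eqI)

section \<open>The tower of wreath products and its projections\<close>

primrec tower :: "nat \<Rightarrow> (int list \<Rightarrow> int list) set"
  where "tower 0 = {id}"
  | "tower (Suc n) = {wr n f g | f g. g \<in> tower n}"

declare tower.simps(2) [simp del]

lemma tower_permutes: "g \<in> tower n \<Longrightarrow> g permutes pts n"
  by (induction n arbitrary: g) (auto simp: wr_permutes permutes_id tower.simps(2))

lemma wr_tower: "g \<in> tower n \<Longrightarrow> wr n f g \<in> tower (Suc n)"
  by (auto simp: tower.simps(2))

lemma tower_SucE:
  assumes "h \<in> tower (Suc n)"
  obtains f g where "g \<in> tower n" "g permutes pts n" "h = wr n f g"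
  using assms tower_permutes by (auto simp: tower.simps(2))

lemma tower_id: "id \<in> tower n"
proof (induction n)
  case (Suc n)
  then show ?case using wr_tower[of id n "\<lambda>_. 0"] by (simp only: wr_0_id)
qed (simp add: id_def)

lemma subgroup_tower: "subgroup (tower n) (Sym (pts n))"
proof (rule group.subgroupI[OF group_Sym])
  show "tower n \<subseteq> carrier (Sym (pts n))" using tower_permutes by auto
  show "tower n \<noteq> {}" using tower_id by blast
  show "g \<otimes>\<^bsub>Sym (pts n)\<^esub> h \<in> tower n" if "g \<in> tower n" "h \<in> tower n" for g h
    using that
  proof (induction n arbitrary: g h)
    case (Suc n)
    then obtain f a f' a' where "g = wr n f a" "h = wr n f' a'" "a \<in> tower n" "a' \<in> tower n"
      "a' permutes pts n" by (meson tower_SucE)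
    then show ?case using wr_tower[OF Suc.IH[of a a', unfolded mult_Sym]]
      unfolding mult_Sym by (simp only: wr_comp)
  qed simp
  show "inv\<^bsub>Sym (pts n)\<^esub> g \<in> tower n" if "g \<in> tower n" for g
  proof -
    have "\<exists>h\<in>tower n. h \<circ> g = id"
      using that
    proof (induction n arbitrary: g)
      case (Suc n)
      then obtain f a where a: "g = wr n f a" "a \<in> tower n" "a permutes pts n" by (meson tower_SucE)
      with Suc.IH obtain b where b: "b \<in> tower n" "b \<circ> a = id" by blast
      have "wr n (\<lambda>x. - f (b x)) b \<circ> g = wr n (\<lambda>_. 0) id"
        using b(2) pointfree_idE[OF b(2)] by (simp add: a wr_comp)
      with b show ?case by (metis wr_0_id wr_tower)
    qed simp
    then obtain h where h: "h \<in> tower n" "h \<circ> g = id" by blast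
    then have "inv\<^bsub>Sym (pts n)\<^esub> g = h"
      using that tower_permutes by (intro group.inv_equality[OF group_Sym]) auto
    with h show ?thesis by simp
  qed
qed

lemma finite_tower [simp]: "finite (tower n)"
  using subgroup.subset[OF subgroup_tower] finite_Sym[OF finite_pts] by (rule finite_subset)

abbreviation TG :: "nat \<Rightarrow> (int list \<Rightarrow> int list) monoid"
  where "TG n \<equiv> Sym (pts n)\<lparr>carrier := tower n\<rparr>"

lemma group_TG [simp]: "group (TG n)"
  by (rule group.subgroup_imp_group[OF group_Sym subgroup_tower])

text \<open>The action on tails, read off at head 0; for elements of the tower the choice of head is
  immaterial. Outside \<open>pts n\<close> it is the identity, as \<open>permutes\<close>
  demands.\<close>

definition proj :: "nat \<Rightarrow> (int list \<Rightarrow> int list) \<Rightarrow> int list \<Rightarrow> int list"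
  where "proj n h x = (if x \<in> pts n then tl (h (0 # x)) else x)"

lemma proj_wr [simp]:
  assumes "g permutes pts n"
  shows "proj n (wr n f g) = g"
proof
  fix x show "proj n (wr n f g) x = g x"
    using p_gt_1 permutes_not_in[OF assms] by (simp add: proj_def wr_Cons)
qed

lemma proj_hom: "group_hom (TG (Suc n)) (TG n) (proj n)"
proof -
  have "proj n \<in> hom (TG (Suc n)) (TG n)"
  proof (rule homI)
    fix h assume "h \<in> carrier (TG (Suc n))"
    then have "h \<in> tower (Suc n)" by simp
    then show "proj n h \<in> carrier (TG n)" by (elim tower_SucE) simp
  next
    fix g h assume "g \<in> carrier (TG (Suc n))" "h \<in> carrier (TG (Suc n))"
    then have "g \<in> tower (Suc n)" "h \<in> tower (Suc n)" by auto
    then show "proj n (g \<otimes>\<^bsub>TG (Suc n)\<^esub> h) = proj n g \<otimes>\<^bsub>TG n\<^esub> proj n h"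
      by (elim tower_SucE) (simp add: wr_comp permutes_compose)
  qed
  then show ?thesis by (simp add: group_hom_def group_hom_axioms_def)
qed

sublocale proj: group_hom "TG (Suc n)" "TG n" "proj n" for n
  by (rule proj_hom)

lemma proj_surj: "proj n ` tower (Suc n) = tower n"
proof
  show "proj n ` tower (Suc n) \<subseteq> tower n" by (auto elim!: tower_SucE)
  show "tower n \<subseteq> proj n ` tower (Suc n)"
  proof
    fix g assume "g \<in> tower n"
    then have "g = proj n (wr n (\<lambda>_. 0) g)" "wr n (\<lambda>_. 0) g \<in> tower (Suc n)"
      using tower_permutes wr_tower by auto
    then show "g \<in> proj n ` tower (Suc n)" by blast
  qed
qed

definition kern :: "nat \<Rightarrow> (int list \<Rightarrow> int list) set"
  where "kern n = {wr n f id | f. True}"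

lemma kern_le: "kern n \<subseteq> tower (Suc n)"
  using wr_tower[OF tower_id] by (auto simp: kern_def)

lemma kernel_proj: "kernel (TG (Suc n)) (TG n) (proj n) = kern n"
proof
  show "kernel (TG (Suc n)) (TG n) (proj n) \<subseteq> kern n"
    by (auto simp: kernel_def kern_def elim!: tower_SucE)
  show "kern n \<subseteq> kernel (TG (Suc n)) (TG n) (proj n)"
    using kern_le by (auto simp: kernel_def kern_def permutes_id subset_iff)
qed

lemma wr_normal_form: "wr n f g = wr n (\<lambda>x\<in>pts n. f x mod int p) g"
  by (rule wr_eqI) auto

lemma card_kern: "card (kern n) = p ^ (p ^ n)"
proof -
  have "kern n = (\<lambda>f. wr n f id) ` (pts n \<rightarrow>\<^sub>E {0..<int p})"
  proof (intro subset_antisym subsetI)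
    fix h assume "h \<in> kern n"
    then obtain f where "h = wr n f id" by (auto simp: kern_def)
    then have "h = wr n (\<lambda>x\<in>pts n. f x mod int p) id" using wr_normal_form by metis
    moreover have "(\<lambda>x\<in>pts n. f x mod int p) \<in> pts n \<rightarrow>\<^sub>E {0..<int p}" by auto
    ultimately show "h \<in> (\<lambda>f. wr n f id) ` (pts n \<rightarrow>\<^sub>E {0..<int p})" by blast
  qed (auto simp: kern_def)
  moreover have "inj_on (\<lambda>f. wr n f id) (pts n \<rightarrow>\<^sub>E {0..<int p})"
  proof (rule inj_onI)
    fix f g assume fg: "f \<in> pts n \<rightarrow>\<^sub>E {0..<int p}" "g \<in> pts n \<rightarrow>\<^sub>E {0..<int p}" "wr n f id = wr n g id"
    have "f x = g x" if "x \<in> pts n" for x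
    proof -
      have "f x \<in> {0..<int p}" "g x \<in> {0..<int p}" using fg that by auto
      then show ?thesis using wr_eqD(1)[OF fg(3) that] by simp
    qed
    then show "f = g" using fg PiE_ext by blast
  qed
  ultimately show ?thesis by (simp add: card_image card_PiE card_pts)
qed

lemma card_tower_Suc: "card (tower (Suc n)) = p ^ (p ^ n) * card (tower n)"
  using proj.card_image_times_kernel[of n] by (simp add: kernel_proj card_kern proj_surj mult.commute)

lemma order_TG: "\<exists>k. order (TG n) = p ^ k"
proof (induction n)
  case 0
  then show ?case by (auto simp: order_def intro: exI[of _ 0])
next
  case (Suc n)
  then show ?case by (auto simp: order_def card_tower_Suc simp flip: power_add)
qed

text \<open>The tail is moved by induction, then a constant shift corrects the head. Transitivity
  later forces the functions of central elements to be constant.\<close>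

lemma tower_transitive:
  assumes "x \<in> pts n" "y \<in> pts n"
  shows "\<exists>g\<in>tower n. g x = y"
  using assms
proof (induction n arbitrary: x y)
  case 0
  then show ?case by (simp add: pts_0)
next
  case (Suc n)
  obtain a u b v where xy: "x = a # u" "0 \<le> a" "a < int p" "u \<in> pts n"
    "y = b # v" "0 \<le> b" "b < int p" "v \<in> pts n"
    using Suc.prems by (meson pts_SucE)
  then obtain g where "g \<in> tower n" "g u = v" using Suc.IH by blast
  then have "wr n (\<lambda>_. b - a) g \<in> tower (Suc n)" "wr n (\<lambda>_. b - a) g x = y"
    using xy wr_tower by (auto simp: wr_Cons)
  then show ?case by blast
qed

section \<open>The tower is a Sylow subgroup\<close>

text \<open>Passing from \<open>fact (p * m)\<close> to \<open>fact (p * Suc m)\<close> adds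
  \<open>p\<close> factors, of which only the last, \<open>p * Suc m\<close>, is divisible by
  \<open>p\<close>.\<close>

lemma multiplicity_fact_mult: "multiplicity p (fact (p * m) :: nat) = m + multiplicity p (fact m :: nat)"
proof (induction m)
  case (Suc m)
  have block: "fact (p * m + j) = (fact (p * m) :: nat) * (\<Prod>i\<in>{1..j}. p * m + i)" for j
    by (induction j) (simp_all add: algebra_simps)
  have nd: "\<not> p dvd (\<Prod>i\<in>{1..p - 1}. p * m + i)"
  proof
    assume "p dvd (\<Prod>i\<in>{1..p - 1}. p * m + i)"
    then obtain i where "i \<in> {1..p - 1}" "p dvd p * m + i"
      using prime_dvd_prod_iff[OF _ prime_p, of "{1..p - 1}" "\<lambda>i. p * m + i"] by blast
    then show False using p_gt_1 by (auto dest!: dvd_imp_le simp: dvd_add_right_iff)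
  qed
  have "p * Suc m = p * m + (p - 1) + 1" using p_gt_1 by simp
  then have "fact (p * Suc m) = (fact (p * m) :: nat) * (\<Prod>i\<in>{1..p - 1}. p * m + i) * (p * Suc m)"
    using block[of "p - 1"] by (metis Suc_eq_plus1 fact_Suc mult.commute of_nat_id)
  moreover have "multiplicity p \<dots> = multiplicity p (fact (p * m) :: nat) + 0 + (1 + multiplicity p (Suc m))"
  proof -
    have "multiplicity p (p * Suc m) = 1 + multiplicity p (Suc m)"
      using prime_p p_gt_1 by (subst prime_elem_multiplicity_mult_distrib) auto
    then show ?thesis
      using prime_p p_gt_1 nd
      by (simp add: prime_elem_multiplicity_mult_distrib not_dvd_imp_multiplicity_0 del: mult_Suc_right)
  qed
  moreover have "multiplicity p (fact (Suc m) :: nat) = multiplicity p (Suc m) + multiplicity p (fact m :: nat)"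
    using prime_p by (simp add: prime_elem_multiplicity_mult_distrib del: mult_Suc)
  ultimately show ?case using Suc by simp
qed simp

text \<open>The order of the tower and the \<open>p\<close>-part of \<open>fact (p ^ n)\<close> obey
  the same recursion: the step from \<open>n\<close> to \<open>Suc n\<close> contributes the factor
  \<open>p ^ (p ^ n)\<close>.\<close>

lemma tower_sylow: "sylow_subgroup p (tower n) (Sym (pts n))"
proof -
  have "card (tower n) = p ^ multiplicity p (fact (p ^ n) :: nat)"
  proof (induction n)
    case (Suc n)
    then show ?case by (simp add: card_tower_Suc multiplicity_fact_mult power_add)
  qed simp
  then show ?thesis
    using subgroup_tower finite_Sym[OF finite_pts]
    by (simp add: sylow_subgroup_def order_def card_permutations card_pts)
qed

section \<open>Abelian normal subgroups\<close>

lemma TG_simps [simp]: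
  "carrier (TG n) = tower n" "\<one>\<^bsub>TG n\<^esub> = id" "f \<otimes>\<^bsub>TG n\<^esub> g = f \<circ> g"
  by simp_all

lemma pow_TG: "g [^]\<^bsub>TG n\<^esub> (i::nat) = g ^^ i"
  by (induction i) (simp_all add: nat_pow_def Sym_def funpow_Suc_right del: funpow.simps(2))

text \<open>Both products add the same values of \<open>f\<close>, so only the effect of
  \<open>g\<close> on the arguments of \<open>h\<close> remains to compare. The criterion drives the
  computation of the center, the bounds on abelian normal subgroups and the uniqueness of
  \<open>vkern\<close>.\<close>

lemma wr_commutes_with_kern_iff:
  assumes "g permutes pts n"
  shows "wr n f g \<circ> wr n h id = wr n h id \<circ> wr n f g
    \<longleftrightarrow> (\<forall>x\<in>pts n. h (g x) mod int p = h x mod int p)"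
proof -
  have "wr n f g \<circ> wr n h id = wr n (\<lambda>x. h x + f x) g"
    by (simp add: wr_comp[OF permutes_id])
  moreover have "wr n h id \<circ> wr n f g = wr n (\<lambda>x. f x + h (g x)) g"
    using assms by (simp add: wr_comp)
  ultimately show ?thesis
    using assms by (auto simp: wr_eq_iff add.commute mod_eq_dvd_iff algebra_simps dvd_diff_commute)
qed

lemma kern_pow: "wr n f id ^^ j = wr n (\<lambda>x. int j * f x) id"
proof (induction j)
  case (Suc j)
  have "wr n f id ^^ Suc j = wr n f id \<circ> wr n (\<lambda>x. int j * f x) id"
    by (simp only: funpow.simps(2) Suc)
  also have "\<dots> = wr n (\<lambda>x. int j * f x + f (id x)) (id \<circ> id)"
    by (rule wr_comp[OF permutes_id])
  also have "\<dots> = wr n (\<lambda>x. int (Suc j) * f x) id"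
    by (rule wr_eqI) (simp_all add: algebra_simps)
  finally show ?case .
qed (simp only: funpow.simps(1) of_nat_0 mult_zero_left wr_0_id)

definition commuting :: "('a \<Rightarrow> 'a) set \<Rightarrow> bool"
  where "commuting L \<longleftrightarrow> (\<forall>a\<in>L. \<forall>b\<in>L. a \<circ> b = b \<circ> a)"

lemma commutingD: "commuting L \<Longrightarrow> a \<in> L \<Longrightarrow> b \<in> L \<Longrightarrow> a \<circ> b = b \<circ> a"
  by (simp add: commuting_def)

lemma kern_commute:
  assumes "a \<in> kern n" "b \<in> kern n"
  shows "a \<circ> b = b \<circ> a"
  using assms wr_commutes_with_kern_iff[OF permutes_id] by (auto simp: kern_def)

lemma finite_kern: "finite (kern n)"
  by (rule finite_subset[OF kern_le finite_tower])

lemma kern_exponent: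
  assumes "a \<in> kern n"
  shows "a ^^ p = id"
proof -
  obtain f where a: "a = wr n f id" using assms by (auto simp: kern_def)
  have "wr n (\<lambda>x. int p * f x) id = wr n (\<lambda>_. 0) id" by (rule wr_eqI) simp_all
  then show ?thesis by (simp add: a kern_pow wr_0_id)
qed

lemma kern_normal: "kern n \<lhd> TG (Suc n)"
  using proj.normal_kernel[of n] by (simp add: kernel_proj)

section \<open>The center of the tower\<close>

text \<open>The generator of the center, of order \<open>p\<close>: it raises the head of every word
  by one. With index \<open>n\<close> it lives in \<open>tower (Suc n)\<close>.\<close>

definition zeta :: "nat \<Rightarrow> int list \<Rightarrow> int list"
  where "zeta n = wr n (\<lambda>_. 1) id"

lemma zeta_permutes [simp]: "zeta n permutes pts (Suc n)"
  by (simp add: zeta_def wr_permutes permutes_id)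

lemma zeta_kern: "zeta n \<in> kern n"
  by (auto simp: zeta_def kern_def)

lemma zeta_tower: "zeta n \<in> tower (Suc n)"
  using zeta_kern kern_le by blast

lemma zeta_pow: "zeta n ^^ j = wr n (\<lambda>_. int j) id"
  by (simp add: zeta_def kern_pow)

lemma pts_nonempty: "pts n \<noteq> {}"
  using card_pts[of n] p_gt_1 by (metis card.empty not_one_less_zero power_eq_0_iff)

lemma zeta_pow_eq_iff: "zeta n ^^ i = zeta n ^^ j \<longleftrightarrow> [i = j] (mod p)"
  using pts_nonempty by (auto simp: zeta_pow wr_eq_iff permutes_id cong_def simp flip: zmod_int)

lemma zeta_central: "zeta n \<in> center (TG (Suc n))"
  using zeta_tower wr_commutes_with_kern_iff[of _ n _ "\<lambda>_. 1"]
  by (auto simp: center_def zeta_def elim!: tower_SucE)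

text \<open>Commuting with \<open>kern n\<close> forces the action on tails to be trivial; commuting
  with lifts of \<open>tower n\<close> makes the function invariant under a transitive group, hence
  constant.\<close>

lemma center_TG:
  assumes "c \<in> center (TG (Suc n))"
  obtains j where "c = zeta n ^^ j"
proof -
  have cT: "c \<in> tower (Suc n)" and comm: "\<And>h. h \<in> tower (Suc n) \<Longrightarrow> c \<circ> h = h \<circ> c"
    using assms by (auto simp: center_def)
  obtain f g where g: "g \<in> tower n" "g permutes pts n" "c = wr n f g"
    using cT by (rule tower_SucE)
  have fixed: "g x = x" for x
  proof (cases "x \<in> pts n")
    case True
    \<comment> \<open>The indicator of \<open>x\<close> as test function: it takes the same value at
      \<open>x\<close> and at \<open>g x\<close> only if \<open>g\<close> fixes
      \<open>x\<close>.\<close>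
    let ?h = "\<lambda>y. if y = x then 1 else 0 :: int"
    have "?h (g x) mod int p = ?h x mod int p"
      using comm[of "wr n ?h id"] wr_tower[OF tower_id] g True
        wr_commutes_with_kern_iff[OF g(2), of f ?h] by blast
    then show ?thesis using p_gt_1 by (auto split: if_splits)
  qed (use g permutes_not_in in metis)
  then have gid: "g = id" by auto
  have inv: "f (q x) mod int p = f x mod int p" if "q \<in> tower n" "x \<in> pts n" for q x
  proof -
    have "c \<circ> wr n (\<lambda>_. 0) q = wr n (\<lambda>_. 0) q \<circ> c" using comm wr_tower that by blast
    then show ?thesis
      using wr_commutes_with_kern_iff[OF tower_permutes[OF that(1)], of "\<lambda>_. 0" f] that(2)
      by (simp add: g(3) gid)
  qed
  obtain x0 where x0: "x0 \<in> pts n" using pts_nonempty by blast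
  have "c = wr n (\<lambda>_. int (nat (f x0 mod int p))) id"
    unfolding g(3) gid
  proof (rule wr_eqI)
    fix x assume "x \<in> pts n"
    then obtain q where "q \<in> tower n" "q x0 = x" using tower_transitive x0 by blast
    then show "f x mod int p = int (nat (f x0 mod int p)) mod int p" using inv[OF _ x0] by force
  qed simp
  then show ?thesis using that[of "nat (f x0 mod int p)"] by (simp only: zeta_pow)
qed

text \<open>The normal subgroup contains a nontrivial central element, a power of
  \<open>zeta n\<close> with exponent prime to \<open>p\<close>; inverting the exponent modulo
  \<open>p\<close> recovers \<open>zeta n\<close>.\<close>

lemma zeta_in_normal:
  assumes N: "N \<lhd> TG (Suc n)" "N \<noteq> {id}"
  shows "zeta n \<in> N"
proof -
  obtain k where k: "order (TG (Suc n)) = p ^ k" using order_TG by blast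
  obtain c where c: "c \<in> N" "c \<noteq> id" "c \<in> center (TG (Suc n))"
    using group.p_group_normal_meets_center[OF group_TG prime_p k N(1)] N(2) by auto
  obtain j where j: "c = zeta n ^^ j" using c(3) by (rule center_TG)
  have "\<not> p dvd j"
  proof
    assume "p dvd j"
    then have "c = zeta n ^^ 0" unfolding j zeta_pow_eq_iff by (simp add: cong_0_iff)
    with c show False by simp
  qed
  then have "coprime j p" using prime_p prime_imp_coprime coprime_commute by blast
  then obtain i where i: "[j * i = 1] (mod p)" using cong_solve_coprime_nat[of j p] by auto
  have "c ^^ i \<in> N"
  proof (induction i)
    case (Suc i)
    then show ?case using c(1) subgroup.m_closed[OF normal_imp_subgroup[OF N(1)], of c "c ^^ i"]
      by (simp only: funpow.simps(2) TG_simps)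
  qed (use subgroup.one_closed[OF normal_imp_subgroup[OF N(1)]] in \<open>simp only: funpow.simps(1) TG_simps\<close>)
  moreover have "c ^^ i = zeta n ^^ 1"
    unfolding j funpow_mult zeta_pow_eq_iff by (rule i)
  ultimately show ?thesis by simp
qed

section \<open>Functions invariant under the center of the level below, and abelian normal
  subgroups\<close>

text \<open>Invariance modulo \<open>p\<close> under \<open>zeta m\<close> amounts to dependence on
  the tail of the word only; \<open>zinvD\<close> and \<open>zinv_tl\<close> are the two
  directions.\<close>

definition zinv :: "nat \<Rightarrow> (int list \<Rightarrow> int) \<Rightarrow> bool"
  where "zinv m f \<longleftrightarrow> (\<forall>x\<in>pts (Suc m). f (zeta m x) mod int p = f x mod int p)"

lemma zinvD:
  assumes "zinv m f" "z # x \<in> pts (Suc m)"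
  shows "f (z # x) mod int p = f (0 # x) mod int p"
proof -
  have z: "0 \<le> z" "z < int p" "x \<in> pts m" using assms(2) by auto
  have "f ((zeta m ^^ j) (0 # x)) mod int p = f (0 # x) mod int p" for j
  proof (induction j)
    case (Suc j)
    have "(zeta m ^^ j) (0 # x) \<in> pts (Suc m)"
      using z p_gt_1 by (simp add: zeta_pow wr_Cons)
    then show ?case using assms(1) Suc by (simp add: zinv_def)
  qed simp
  from this[of "nat z"] show ?thesis using z by (simp add: zeta_pow wr_Cons)
qed

lemma zinv_tl: "zinv m (\<lambda>l. \<gamma> (tl l))"
  by (auto simp: zinv_def zeta_def wr_Cons elim!: pts_SucE)

lemma wr_zinv:
  assumes "zinv m f"
  shows "wr (Suc m) f g = wr (Suc m) (\<lambda>l. (\<lambda>x\<in>pts m. f (0 # x) mod int p) (tl l)) g"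
proof (rule wr_eqI)
  fix l assume l: "l \<in> pts (Suc m)"
  then obtain z x where x: "l = z # x" "x \<in> pts m" by (elim pts_SucE)
  then show "f l mod int p = (\<lambda>x\<in>pts m. f (0 # x) mod int p) (tl l) mod int p"
    using zinvD[OF assms, of z x] l by simp
qed simp

text \<open>The elements of \<open>kern (Suc m)\<close> that commute with lifts of
  \<open>zeta m\<close>. Functions on \<open>pts m\<close> instead of \<open>pts (Suc m)\<close>
  describe them, which makes the set small.\<close>

definition zkern :: "nat \<Rightarrow> (int list \<Rightarrow> int list) set"
  where "zkern m = {wr (Suc m) f id | f. zinv m f}"

lemma card_functions: "card (pts m \<rightarrow>\<^sub>E {0..<int p}) = p ^ (p ^ m)"
  by (simp add: card_PiE card_pts)

lemma finite_functions: "finite (pts m \<rightarrow>\<^sub>E {0..<int p})"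
  by (simp add: finite_PiE)

lemma zkern_sub: "zkern m \<subseteq> (\<lambda>\<gamma>. wr (Suc m) (\<lambda>l. \<gamma> (tl l)) id) ` (pts m \<rightarrow>\<^sub>E {0..<int p})"
proof
  fix h assume "h \<in> zkern m"
  then obtain f where f: "h = wr (Suc m) f id" "zinv m f" by (auto simp: zkern_def)
  have "(\<lambda>x\<in>pts m. f (0 # x) mod int p) \<in> pts m \<rightarrow>\<^sub>E {0..<int p}" by auto
  then show "h \<in> (\<lambda>\<gamma>. wr (Suc m) (\<lambda>l. \<gamma> (tl l)) id) ` (pts m \<rightarrow>\<^sub>E {0..<int p})"
    by (rule rev_image_eqI) (simp only: f(1) wr_zinv[OF f(2), symmetric])
qed

lemma card_zkern: "finite (zkern m)" "card (zkern m) \<le> p ^ (p ^ m)"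
proof -
  show "finite (zkern m)" by (rule finite_surj[OF finite_functions zkern_sub])
  show "card (zkern m) \<le> p ^ (p ^ m)"
    using surj_card_le[OF finite_functions zkern_sub] by (simp only: card_functions)
qed

text \<open>The image of \<open>L\<close> is a nontrivial normal subgroup and so contains
  \<open>zeta m\<close>; a preimage in \<open>L\<close> commutes with
  \<open>L \<inter> kern n\<close>, which makes the functions there invariant. The index
  \<open>n\<close> is not 0 because \<open>tower 0\<close> is trivial.\<close>

lemma abelian_normal_not_in_kern:
  assumes L: "L \<lhd> TG (Suc n)" and comm: "commuting L"
    and not_le: "\<not> L \<subseteq> kern n"
  obtains m a where "n = Suc m" "wr n a (zeta m) \<in> L" "L \<inter> kern n \<subseteq> zkern m"
    "proj n ` L \<lhd> TG n" "commuting (proj n ` L)"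
proof -
  have LT: "L \<subseteq> tower (Suc n)" using subgroup.subset[OF normal_imp_subgroup[OF L]] by simp
  have E: "proj n ` L \<lhd> TG n"
    using normal.surj_hom_normal_subgroup[OF L proj_hom] proj_surj by simp
  have ET: "proj n ` L \<subseteq> tower n" using LT proj_surj by blast
  obtain l where l: "l \<in> L" "l \<notin> kern n" using not_le by blast
  then have nid: "proj n l \<noteq> id" using LT unfolding kernel_proj[symmetric] by (auto simp: kernel_def)
  then have ne: "proj n ` L \<noteq> {id}" using l by blast
  have "n \<noteq> 0"
  proof
    assume "n = 0"
    then have "proj n ` L \<subseteq> {id}" using ET by simp
    with l nid show False by blast
  qed
  then obtain m where m: "n = Suc m" using not0_implies_Suc by blast
  have "zeta m \<in> proj n ` L" using zeta_in_normal E ne by (simp add: m)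
  then obtain k where k: "k \<in> L" "proj n k = zeta m" by force
  then have "k \<in> tower (Suc n)" using LT by blast
  then obtain a where a: "k = wr n a (zeta m)" using k(2) by (elim tower_SucE) auto
  have cap: "L \<inter> kern n \<subseteq> zkern m"
  proof
    fix h assume h: "h \<in> L \<inter> kern n"
    then obtain f where f: "h = wr n f id" by (auto simp: kern_def)
    have "wr n a (zeta m) \<circ> wr n f id = wr n f id \<circ> wr n a (zeta m)"
      using commutingD[OF comm, of k h] k h by (simp only: a f Int_iff)
    then have "zinv m f"
      using wr_commutes_with_kern_iff[of "zeta m" n a f] by (simp add: m zinv_def)
    then show "h \<in> zkern m" by (auto simp: zkern_def f m)
  qed
  have "a \<circ> b = b \<circ> a" if ab0: "a \<in> proj n ` L" "b \<in> proj n ` L" for a b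
  proof -
    obtain a' b' where ab: "a' \<in> L" "b' \<in> L" "a = proj n a'" "b = proj n b'" using ab0 by blast
    then have "proj n (a' \<circ> b') = a \<circ> b" "proj n (b' \<circ> a') = b \<circ> a"
      using proj.hom_mult[of a' n b'] proj.hom_mult[of b' n a'] LT by auto
    with commutingD[OF comm ab(1,2)] show ?thesis by (simp only:)
  qed
  then have "commuting (proj n ` L)" by (simp only: commuting_def) blast
  with cap show ?thesis using that m a k E by blast
qed

lemma card_via_proj:
  assumes "subgroup L (TG (Suc n))"
  shows "card L = card (proj n ` L) * card (L \<inter> kern n)"
  using proj.card_subgroup_image[OF _ assms] by (simp add: kernel_proj)

text \<open>In the step to \<open>Suc n\<close>, if \<open>L\<close> is not inside the kernel,
  induction bounds the image and invariance bounds the intersection, both by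
  \<open>p ^ (p ^ n)\<close>; the product \<open>p ^ (2 * p ^ n)\<close> is small enough since
  \<open>2 \<le> p\<close>.\<close>

lemma card_abelian_normal:
  assumes "L \<lhd> TG (Suc n)" "commuting L"
  shows "card L \<le> p ^ (p ^ n)"
  using assms
proof (induction n arbitrary: L)
  case 0
  show ?case
  proof (cases "L \<subseteq> kern 0")
    case True
    then show ?thesis using card_mono[OF finite_kern, of L 0] by (simp only: card_kern)
  next
    case False
    then obtain m where "0 = Suc m" by (rule abelian_normal_not_in_kern[OF 0])
    then show ?thesis by simp
  qed
next
  case (Suc n)
  show ?case
  proof (cases "L \<subseteq> kern (Suc n)")
    case True
    have "card L \<le> card (kern (Suc n))"
      using True by (rule card_mono[OF finite_kern])
    then show ?thesis by (simp add: card_kern)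
  next
    case False
    obtain m a where m: "Suc n = Suc m" "L \<inter> kern (Suc n) \<subseteq> zkern m"
      and E: "proj (Suc n) ` L \<lhd> TG (Suc n)" "commuting (proj (Suc n) ` L)"
      by (rule abelian_normal_not_in_kern[OF Suc.prems False])
    have "card (L \<inter> kern (Suc n)) \<le> p ^ (p ^ n)"
      using card_mono[OF card_zkern(1) m(2)] card_zkern(2)[of m] m(1) by simp
    then have "card L \<le> p ^ (p ^ n) * p ^ (p ^ n)"
      using card_via_proj[OF normal_imp_subgroup[OF Suc.prems(1)]] Suc.IH[OF E]
      by (simp add: mult_le_mono)
    also have "\<dots> = p ^ (2 * p ^ n)" by (simp add: mult_2 power_add)
    also have "\<dots> \<le> p ^ (p * p ^ n)"
      using p_gt_1 by (intro power_increasing mult_le_mono) auto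
    finally show ?thesis by simp
  qed
qed

section \<open>Images of the kernel under automorphisms\<close>

lemma auto_kern:
  assumes \<alpha>: "\<alpha> \<in> auto (TG (Suc n))"
  shows "\<alpha> ` kern n \<lhd> TG (Suc n)" "card (\<alpha> ` kern n) = p ^ (p ^ n)"
    "commuting (\<alpha> ` kern n)"
    "\<And>a. a \<in> \<alpha> ` kern n \<Longrightarrow> a ^^ p = id"
proof -
  have hom: "group_hom (TG (Suc n)) (TG (Suc n)) \<alpha>"
    using auto_hom[OF \<alpha>] by (simp add: group_hom_def group_hom_axioms_def)
  show "\<alpha> ` kern n \<lhd> TG (Suc n)"
    using group.auto_image_normal[OF group_TG \<alpha> kern_normal] .
  have "inj_on \<alpha> (kern n)"
    using auto_bij[OF \<alpha>] kern_le by (auto simp: bij_betw_def intro: inj_on_subset)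
  then show "card (\<alpha> ` kern n) = p ^ (p ^ n)" by (simp add: card_image card_kern)
  have "a \<circ> b = b \<circ> a" if ab0: "a \<in> \<alpha> ` kern n" "b \<in> \<alpha> ` kern n" for a b
  proof -
    obtain x y where xy: "x \<in> kern n" "y \<in> kern n" "a = \<alpha> x" "b = \<alpha> y" using ab0 by blast
    then have "x \<in> tower (Suc n)" "y \<in> tower (Suc n)" using kern_le by auto
    then have "\<alpha> (x \<circ> y) = a \<circ> b" "\<alpha> (y \<circ> x) = b \<circ> a"
      using group_hom.hom_mult[OF hom, of x y] group_hom.hom_mult[OF hom, of y x] xy by auto
    with kern_commute[OF xy(1,2)] show ?thesis by (simp only:)
  qed
  then show "commuting (\<alpha> ` kern n)" by (simp only: commuting_def) blast
  show "a ^^ p = id" if a0: "a \<in> \<alpha> ` kern n" for a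
  proof -
    obtain x where x: "x \<in> kern n" "a = \<alpha> x" using a0 by blast
    then have "x \<in> tower (Suc n)" using kern_le by auto
    then show ?thesis
      using group_hom.hom_nat_pow[OF hom, of x p] group_hom.hom_one[OF hom] kern_exponent[OF x(1)] x(2)
      by (simp add: pow_TG)
  qed
qed

text \<open>An image not contained in \<open>kern n\<close> would have order at most
  \<open>p ^ (2 * p ^ m)\<close> with \<open>n = Suc m\<close>; comparison with
  \<open>p ^ (p ^ n)\<close> gives \<open>p \<le> 2\<close>.\<close>

lemma auto_preserves_kern:
  assumes \<alpha>: "\<alpha> \<in> auto (TG (Suc n))" and odd: "p \<noteq> 2"
  shows "\<alpha> ` kern n \<subseteq> kern n"
proof (rule ccontr)
  note L = auto_kern[OF \<alpha>]
  assume "\<not> \<alpha> ` kern n \<subseteq> kern n"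
  then obtain m a where m: "n = Suc m" "\<alpha> ` kern n \<inter> kern n \<subseteq> zkern m"
    and E: "proj n ` \<alpha> ` kern n \<lhd> TG n" "commuting (proj n ` \<alpha> ` kern n)"
    by (rule abelian_normal_not_in_kern[OF L(1,3)])
  have "card (proj n ` \<alpha> ` kern n) \<le> p ^ (p ^ m)"
    using card_abelian_normal[of "proj n ` \<alpha> ` kern n" m] E by (simp add: m)
  moreover have "card (\<alpha> ` kern n \<inter> kern n) \<le> p ^ (p ^ m)"
    using card_mono[OF card_zkern(1) m(2)] card_zkern(2)[of m] by simp
  ultimately have "p ^ (p ^ n) \<le> p ^ (p ^ m) * p ^ (p ^ m)"
    using card_via_proj[OF normal_imp_subgroup[OF L(1)]] L(2) by (simp add: mult_le_mono)
  also have "\<dots> = p ^ (2 * p ^ m)" by (simp add: mult_2 power_add)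
  finally have "p * p ^ m \<le> 2 * p ^ m" using p_gt_1 by (simp add: m)
  then show False using p_gt_1 odd by simp
qed

text \<open>For \<open>p = 2\<close>, the image of \<open>kern\<close> under the automorphism induced by the outer automorphism of
  the dihedral group of order 8 that acts on the last two coordinates.\<close>
definition vkern :: "nat \<Rightarrow> (int list \<Rightarrow> int list) set"
  where "vkern m = {wr (Suc m) g (wr m f id) | g f. zinv m g}"

lemma card_vkern: "finite (vkern m)" "card (vkern m) \<le> p ^ (p ^ m) * p ^ (p ^ m)"
proof -
  let ?F = "pts m \<rightarrow>\<^sub>E {0..<int p}"
  let ?h = "\<lambda>(\<gamma>, f). wr (Suc m) (\<lambda>l. \<gamma> (tl l)) (wr m f id)"
  have sub: "vkern m \<subseteq> ?h ` (?F \<times> ?F)"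
  proof
    fix h assume "h \<in> vkern m"
    then obtain g f where h: "h = wr (Suc m) g (wr m f id)" "zinv m g" by (auto simp: vkern_def)
    have "h = ?h (\<lambda>x\<in>pts m. g (0 # x) mod int p, \<lambda>x\<in>pts m. f x mod int p)"
      using wr_zinv[OF h(2)] wr_normal_form[of m f id] by (simp add: h(1))
    then show "h \<in> ?h ` (?F \<times> ?F)" by (rule image_eqI) auto
  qed
  have fin: "finite (?F \<times> ?F)" using finite_functions by blast
  show "finite (vkern m)" by (rule finite_surj[OF fin sub])
  show "card (vkern m) \<le> p ^ (p ^ m) * p ^ (p ^ m)"
    using surj_card_le[OF fin sub] by (simp only: card_cartesian_product card_functions)
qed

text \<open>For \<open>p = 2\<close> the counting bound is attained, so with
  \<open>n = Suc m\<close> all of \<open>zkern m\<close> lies in \<open>L\<close>. Commuting with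
  \<open>zkern m\<close> restricts the tail actions to \<open>kern m\<close>; commuting with a lift
  of \<open>zeta m\<close> makes the functions invariant. Counting turns the inclusion into
  equality.\<close>

lemma elementary_normal_eq_vkern:
  assumes 2: "p = 2" and L: "L \<lhd> TG (Suc n)"
    and comm: "commuting L"
    and expo: "\<And>a. a \<in> L \<Longrightarrow> a ^^ p = id"
    and card: "card L = p ^ (p ^ n)" and ne: "L \<noteq> kern n"
  shows "L = vkern (n - 1)"
proof -
  have "\<not> L \<subseteq> kern n"
  proof
    assume "L \<subseteq> kern n"
    then have "L = kern n" using card by (intro card_subset_eq[OF finite_kern]) (simp_all only: card_kern)
    with ne show False by contradiction
  qed
  then obtain m a where m: "n = Suc m" and l: "wr n a (zeta m) \<in> L" and cap: "L \<inter> kern n \<subseteq> zkern m"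
    and E: "proj n ` L \<lhd> TG n" "commuting (proj n ` L)"
    by (rule abelian_normal_not_in_kern[OF L comm])
  \<comment> \<open>Image and intersection each have at most \<open>N\<close> elements and their
    orders multiply to \<open>N * N\<close>, so both bounds are attained.\<close>
  define N where "N = p ^ (p ^ m)"
  have NN: "p ^ (p ^ n) = N * N" by (simp add: N_def m 2 mult_2 flip: power_add)
  have "N > 0" using p_gt_1 by (simp add: N_def)
  have "card (proj n ` L) \<le> N"
    using card_abelian_normal[of "proj n ` L" m] E by (simp add: m N_def)
  moreover have prod: "N * N = card (proj n ` L) * card (L \<inter> kern n)"
    using card_via_proj[OF normal_imp_subgroup[OF L]] card NN by simp
  ultimately have "N * N \<le> N * card (L \<inter> kern n)" by simp
  then have "N \<le> card (L \<inter> kern n)" using \<open>N > 0\<close> by simp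
  then have zk: "zkern m \<subseteq> L"
    using card_seteq[OF card_zkern(1) cap] card_zkern(2)[of m] by (auto simp: N_def)
  have LT: "L \<subseteq> tower (Suc n)" using subgroup.subset[OF normal_imp_subgroup[OF L]] by simp
  \<comment> \<open>Exponent 2 makes \<open>a x\<close> and \<open>a (zeta m x)\<close> sum to 0
    modulo 2; as signs do not matter there, \<open>a\<close> is invariant.\<close>
  have "wr n a (zeta m) \<circ> wr n a (zeta m) = id" using expo[OF l] by (simp add: 2 numeral_2_eq_2)
  then have "wr n (\<lambda>x. a x + a (zeta m x)) (zeta m \<circ> zeta m) = wr n (\<lambda>_. 0) id"
    by (simp add: wr_comp wr_0_id m)
  then have "(a x + a (zeta m x)) mod int p = 0 mod int p" if "x \<in> pts n" for x
    using wr_eqD(1) that by blast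
  note sum0 = this
  have ip: "int p = 2" by (simp add: 2)
  have "zinv m a" unfolding zinv_def
  proof
    fix x assume "x \<in> pts (Suc m)"
    then show "a (zeta m x) mod int p = a x mod int p" using sum0[of x] unfolding m ip by presburger
  qed
  have "L \<subseteq> vkern m"
  proof
    fix h assume h: "h \<in> L"
    then obtain g q where q: "q \<in> tower n" "h = wr n g q" using LT by (meson tower_SucE subsetD)
    then obtain f r where r: "r \<in> tower m" "r permutes pts m" "q = wr m f r"
      unfolding m by (meson tower_SucE)
    have qp: "q permutes pts n" using q tower_permutes by blast
    have "r y = y" for y
    proof (cases "y \<in> pts m")
      case True
      \<comment> \<open>The indicator of the tail \<open>y\<close> is invariant, so it defines an
        element of \<open>zkern m\<close>; commuting with it forces \<open>r\<close> to fix
        \<open>y\<close>.\<close>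
      let ?F = "\<lambda>l. (\<lambda>u. if u = y then 1 else 0 :: int) (tl l)"
      have "wr n ?F id \<in> L" using zk zinv_tl[of m "\<lambda>u. if u = y then 1 else 0"] by (auto simp: zkern_def m)
      then have "wr n g q \<circ> wr n ?F id = wr n ?F id \<circ> wr n g q"
        using commutingD[OF comm] h unfolding q(2) by blast
      then have "?F (q (0 # y)) mod int p = ?F (0 # y) mod int p"
        using wr_commutes_with_kern_iff[OF qp, of g ?F] True p_gt_1 by (simp add: m)
      then show ?thesis using True p_gt_1 by (auto simp: r wr_Cons split: if_splits)
    qed (use r permutes_not_in in metis)
    then have q_eq: "q = wr m f id" using r by (metis eq_id_iff)
    \<comment> \<open>The functions of both products are compared: \<open>q\<close> changes only
      heads, so \<open>a (q x)\<close> cancels against \<open>a x\<close> and the invariance of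
      \<open>g\<close> remains.\<close>
    have "h \<circ> wr n a (zeta m) = wr n a (zeta m) \<circ> h" by (rule commutingD[OF comm h l])
    then have "wr n (\<lambda>x. a x + g (zeta m x)) (q \<circ> zeta m) = wr n (\<lambda>x. g x + a (q x)) (zeta m \<circ> q)"
      using qp by (simp add: q(2) wr_comp m)
    then have eq: "(a x + g (zeta m x)) mod int p = (g x + a (q x)) mod int p" if "x \<in> pts n" for x
      using wr_eqD(1) that by blast
    have "zinv m g"
      unfolding zinv_def
    proof
      fix x assume x: "x \<in> pts (Suc m)"
      then obtain z y where y: "x = z # y" "0 \<le> z" "z < int p" "y \<in> pts m" by (rule pts_SucE)
      then have "a (q x) mod int p = a x mod int p"
        using zinvD[OF \<open>zinv m a\<close>, of "(z + f y) mod int p" y] zinvD[OF \<open>zinv m a\<close>, of z y]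
        by (simp add: q_eq wr_Cons)
      moreover have "(a x + g (zeta m x)) mod int p = (g x + a (q x)) mod int p"
        using eq[of x] x by (simp only: m)
      ultimately show "g (zeta m x) mod int p = g x mod int p"
        unfolding ip by presburger
    qed
    then show "h \<in> vkern m" using q q_eq by (auto simp: vkern_def m)
  qed
  moreover have "card (vkern m) \<le> card L" using card_vkern(2)[of m] card NN by (simp add: N_def)
  ultimately show ?thesis using card_seteq[OF card_vkern(1)] by (simp add: m)
qed

text \<open>The only candidates are \<open>kern n\<close> and \<open>vkern (n - 1)\<close>. If
  \<alpha> moved \<open>kern n\<close> to the other one and its square did not bring it back,
  \<alpha> would send both to the same image.\<close>

lemma auto_square_preserves_kern:
  assumes 2: "p = 2" and \<alpha>: "\<alpha> \<in> auto (TG (Suc n))"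
  shows "\<alpha> ` \<alpha> ` kern n = kern n"
proof (cases "\<alpha> ` kern n = kern n")
  case False
  note L = auto_kern[OF \<alpha>]
  let ?\<beta> = "compose (tower (Suc n)) \<alpha> \<alpha>"
  have \<beta>: "?\<beta> \<in> auto (TG (Suc n))"
    using group.compose_auto[OF group_TG \<alpha> \<alpha>] by simp
  have img: "?\<beta> ` kern n = \<alpha> ` \<alpha> ` kern n"
    using kern_le by (force simp: compose_def)
  note M = auto_kern[OF \<beta>]
  have v: "\<alpha> ` kern n = vkern (n - 1)"
    using elementary_normal_eq_vkern[OF 2 L(1,3,4,2) False] .
  show ?thesis
  proof (rule ccontr)
    assume "\<alpha> ` \<alpha> ` kern n \<noteq> kern n"
    then have "?\<beta> ` kern n = vkern (n - 1)"
      using elementary_normal_eq_vkern[OF 2 M(1,3,4,2)] img by simp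
    then have "\<alpha> ` \<alpha> ` kern n = \<alpha> ` kern n" using v img by simp
    moreover have inj: "inj_on \<alpha> (tower (Suc n))" using auto_bij[OF \<alpha>] by (simp add: bij_betw_def)
    moreover have sub: "\<alpha> ` kern n \<subseteq> tower (Suc n)" using kern_le auto_closed[OF \<alpha>] by auto
    ultimately have "\<alpha> ` kern n = kern n"
      using inj_on_image_eq_iff[OF inj sub kern_le] by simp
    with False show False by blast
  qed
qed simp

section \<open>Automorphisms of the iterated wreath product\<close>

text \<open>Commuting with constant shifts forces the form \<open>wr n f b\<close>; commuting with
  lifts of \<open>tower n\<close> puts \<open>b\<close> into the centralizer one level down, where
  induction applies.\<close>

lemma centralizer_tower: "centralizer (Sym (pts n)) (tower n) \<subseteq> tower n"
proof (induction n)
  case 0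
  show ?case by (auto simp: centralizer_def pts_0)
next
  case (Suc n)
  show ?case
  proof
    fix g assume "g \<in> centralizer (Sym (pts (Suc n))) (tower (Suc n))"
    then have g: "g permutes pts (Suc n)" and comm: "\<And>h. h \<in> tower (Suc n) \<Longrightarrow> g \<circ> h = h \<circ> g"
      by (auto simp: centralizer_def)
    define f where "f x = hd (g (0 # x))" for x
    define b where "b x = (if x \<in> pts n then tl (g (0 # x)) else x)" for x
    have zero: "0 # x \<in> pts (Suc n)" if "x \<in> pts n" for x using that p_gt_1 by simp
    have g0: "g (0 # x) = f x # b x" "b x \<in> pts n" if x: "x \<in> pts n" for x
    proof -
      have "g (0 # x) \<in> pts (Suc n)" using permutes_in_image[OF g] zero[OF x] by simp
      then obtain z y where "g (0 # x) = z # y" "y \<in> pts n" by (elim pts_SucE)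
      then show "g (0 # x) = f x # b x" "b x \<in> pts n" using x by (simp_all add: f_def b_def)
    qed
    have f_range: "0 \<le> f x" "f x < int p" if x: "x \<in> pts n" for x
    proof -
      have "g (0 # x) \<in> pts (Suc n)" using permutes_in_image[OF g] zero[OF x] by simp
      then show "0 \<le> f x" "f x < int p" using g0[OF x] by auto
    qed
    have gz: "g (z # x) = ((z + f x) mod int p) # b x" if zx: "0 \<le> z" "z < int p" "x \<in> pts n" for z x
    proof -
      \<comment> \<open>The constant shift by \<open>z\<close> carries head 0 to head
        \<open>z\<close>, so commuting with it determines \<open>g\<close> from its values at head
        0.\<close>
      have "wr n (\<lambda>_. z) id \<in> tower (Suc n)" using wr_tower[OF tower_id] .
      then have "g (wr n (\<lambda>_. z) id (0 # x)) = wr n (\<lambda>_. z) id (g (0 # x))"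
        using comm by (metis comp_apply)
      then show ?thesis
        using zx g0[OF zx(3)] f_range[OF zx(3)] p_gt_1 by (simp add: wr_Cons add.commute)
    qed
    have g_eq: "g = wr n f b"
    proof
      fix l show "g l = wr n f b l"
      proof (cases "l \<in> pts (Suc n)")
        case True
        then show ?thesis by (elim pts_SucE) (simp add: gz wr_Cons)
      qed (use permutes_not_in[OF g] in \<open>simp add: wr_outside\<close>)
    qed
    have "inj_on b (pts n)"
    proof (rule inj_onI)
      fix x y assume xy: "x \<in> pts n" "y \<in> pts n" "b x = b y"
      \<comment> \<open>The head for which \<open>?z # x\<close> and \<open>0 # y\<close> have the
        same image, so that injectivity of \<open>g\<close> applies.\<close>
      let ?z = "(f y - f x) mod int p"
      have "g (?z # x) = g (0 # y)"
        using xy g0(1)[OF xy(2)] f_range[OF xy(2)] by (simp add: gz mod_simps)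
      then show "x = y" using permutes_inj[OF g] by (auto dest: injD)
    qed
    moreover have "b ` pts n \<subseteq> pts n" using g0(2) by blast
    ultimately have "bij_betw b (pts n) (pts n)"
      unfolding bij_betw_def using endo_inj_surj[OF finite_pts] by blast
    then have b: "b permutes pts n"
      by (rule bij_imp_permutes) (simp add: b_def)
    have "b \<circ> h = h \<circ> b" if h: "h \<in> tower n" for h
    proof -
      have hp: "h permutes pts n" using h by (rule tower_permutes)
      have "g \<circ> wr n (\<lambda>_. 0) h = wr n (\<lambda>_. 0) h \<circ> g" using comm[OF wr_tower[OF h]] .
      then have "wr n (\<lambda>x. 0 + f (h x)) (b \<circ> h) = wr n (\<lambda>x. f x + 0) (h \<circ> b)"
        unfolding g_eq wr_comp[OF hp] wr_comp[OF b] .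
      then show ?thesis
        using wr_eq_iff[OF permutes_compose[OF hp b] permutes_compose[OF b hp]] by blast
    qed
    then have "b \<in> tower n" using Suc.IH b by (auto simp: centralizer_def)
    then show "g \<in> tower (Suc n)" unfolding g_eq by (rule wr_tower)
  qed
qed

section \<open>Induced automorphisms one level down\<close>

abbreviation dsc :: "nat \<Rightarrow> _"
  where "dsc n \<equiv> descend (TG (Suc n)) (TG n) (proj n)"

lemma kern_preservedD:
  assumes "\<alpha> ` kern n \<subseteq> kern n"
  shows "k \<in> kernel (TG (Suc n)) (TG n) (proj n) \<Longrightarrow> \<alpha> k \<in> kernel (TG (Suc n)) (TG n) (proj n)"
  unfolding kernel_proj using assms by blast

lemma dsc_auto:
  assumes "\<alpha> \<in> auto (TG (Suc n))" "\<alpha> ` kern n \<subseteq> kern n"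
  shows "dsc n \<alpha> \<in> auto (TG n)"
  by (rule proj.descend_auto[OF _ _ assms(1) kern_preservedD[OF assms(2)]])
    (simp_all add: proj_surj)

lemma dsc_proj:
  assumes "\<alpha> \<in> auto (TG (Suc n))" "\<alpha> ` kern n \<subseteq> kern n" "x \<in> tower (Suc n)"
  shows "dsc n \<alpha> (proj n x) = proj n (\<alpha> x)"
  by (rule proj.descend_apply[OF auto_hom[OF assms(1)] kern_preservedD[OF assms(2)]])
    (use assms(3) in simp_all)

lemma dsc_funpow:
  assumes "\<alpha> \<in> auto (TG (Suc n))" "\<alpha> ` kern n \<subseteq> kern n"
    and "\<And>x. x \<in> tower (Suc n) \<Longrightarrow> (\<alpha> ^^ q) x = x" and y: "y \<in> tower n"
  shows "(dsc n \<alpha> ^^ q) y = y"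
proof -
  obtain x where x: "x \<in> tower (Suc n)" "y = proj n x" using y proj_surj by blast
  have "(dsc n \<alpha> ^^ q) (proj n x) = proj n ((\<alpha> ^^ q) x)"
    by (rule proj.descend_funpow[OF auto_hom[OF assms(1)] kern_preservedD[OF assms(2)]])
      (use x in simp_all)
  then show ?thesis using assms(3)[OF x(1)] x(2) by simp
qed

lemma dsc_compose:
  assumes "\<alpha> \<in> auto (TG (Suc n))" "\<alpha> ` kern n \<subseteq> kern n"
    and "\<beta> \<in> auto (TG (Suc n))" "\<beta> ` kern n \<subseteq> kern n"
  shows "dsc n (compose (tower (Suc n)) \<alpha> \<beta>) = compose (tower n) (dsc n \<alpha>) (dsc n \<beta>)"
  using proj.descend_compose[OF _ _ assms(1) kern_preservedD[OF assms(2)] assms(3) kern_preservedD[OF assms(4)]]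
  by (simp add: proj_surj)

lemma auto_zeta_pow:
  assumes "\<alpha> \<in> auto (TG (Suc n))"
  shows "\<alpha> (zeta n ^^ j) = \<alpha> (zeta n) ^^ j"
proof -
  have "group_hom (TG (Suc n)) (TG (Suc n)) \<alpha>"
    using auto_hom[OF assms] by (simp add: group_hom_def group_hom_axioms_def)
  from group_hom.hom_nat_pow[OF this, of "zeta n" j] show ?thesis
    using zeta_tower unfolding pow_TG TG_simps by blast
qed

text \<open>A trivial induced automorphism means that \<alpha> moves elements only within cosets of
  \<open>kern n\<close>, and fixing \<open>zeta n\<close> means fixing the center; so
  \<open>coprime_automorphism_trivial\<close> applies with \<open>kern n\<close> as
  \<open>K\<close>.\<close>

lemma automorphism_trivial:
  assumes \<alpha>: "\<alpha> \<in> auto (TG (Suc n))" and k: "\<alpha> ` kern n \<subseteq> kern n"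
    and q: "prime q" "q \<noteq> p" and per: "\<And>x. x \<in> tower (Suc n) \<Longrightarrow> (\<alpha> ^^ q) x = x"
    and top: "\<alpha> (zeta n) = zeta n" and dsc: "\<And>y. y \<in> tower n \<Longrightarrow> dsc n \<alpha> y = y"
    and x: "x \<in> tower (Suc n)"
  shows "\<alpha> x = x"
proof -
  obtain e where e: "order (TG (Suc n)) = p ^ e" using order_TG by blast
  have mem: "\<alpha> x \<otimes>\<^bsub>TG (Suc n)\<^esub> inv\<^bsub>TG (Suc n)\<^esub> x \<in> kern n" if xc: "x \<in> carrier (TG (Suc n))" for x
  proof -
    have cl: "\<alpha> x \<in> carrier (TG (Suc n))" using auto_closed[OF \<alpha> xc] .
    have xT: "x \<in> tower (Suc n)" using xc by simp
    have "proj n (\<alpha> x) = proj n x"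
      using dsc_proj[OF \<alpha> k xT] dsc[of "proj n x"] xT proj_surj by force
    then have "proj n (\<alpha> x \<otimes>\<^bsub>TG (Suc n)\<^esub> inv\<^bsub>TG (Suc n)\<^esub> x) = \<one>\<^bsub>TG n\<^esub>"
      using proj.hom_mult[OF cl proj.G.inv_closed[OF xc]] proj.hom_inv[OF xc]
        proj.H.r_inv[OF proj.hom_closed[OF xc]] by (simp only:)
    then show ?thesis
      unfolding kernel_proj[symmetric] kernel_def
      using proj.G.m_closed[OF cl proj.G.inv_closed[OF xc]] by blast
  qed
  show ?thesis
  proof (rule proj.G.coprime_automorphism_trivial[OF prime_p q e kern_normal _ _ auto_hom[OF \<alpha>] _ mem])
    fix a b assume "a \<in> kern n" "b \<in> kern n"
    then show "a \<otimes>\<^bsub>TG (Suc n)\<^esub> b = b \<otimes>\<^bsub>TG (Suc n)\<^esub> a"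
      unfolding TG_simps by (rule kern_commute)
  next
    fix a assume "a \<in> kern n"
    then show "a [^]\<^bsub>TG (Suc n)\<^esub> p = \<one>\<^bsub>TG (Suc n)\<^esub>"
      unfolding pow_TG TG_simps by (rule kern_exponent)
  next
    fix z assume "z \<in> center (TG (Suc n))"
    then obtain j where "z = zeta n ^^ j" by (rule center_TG)
    then show "\<alpha> z = z" using auto_zeta_pow[OF \<alpha>] top by simp
  qed (use per x in simp_all)
qed

lemma auto_zeta:
  assumes \<alpha>: "\<alpha> \<in> auto (TG (Suc n))"
  obtains j where "\<alpha> (zeta n) = zeta n ^^ j" "\<not> p dvd j"
proof -
  have "\<alpha> (zeta n) \<in> center (TG (Suc n))"
    by (rule auto_center[OF group_TG \<alpha> zeta_central])
  then obtain j where j: "\<alpha> (zeta n) = zeta n ^^ j" by (rule center_TG)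
  have "\<not> p dvd j"
  proof
    assume "p dvd j"
    then have eq: "zeta n ^^ j = zeta n ^^ 0" unfolding zeta_pow_eq_iff by (simp add: cong_0_iff)
    have "\<alpha> (zeta n) = \<alpha> (zeta n ^^ 0)" unfolding auto_zeta_pow[OF \<alpha>, of 0] using j eq by simp
    then have "zeta n ^^ 1 = zeta n ^^ 0"
      using auto_bij[OF \<alpha>] zeta_tower tower_id[of "Suc n"]
      by (auto simp: bij_betw_def dest!: inj_onD)
    then show False unfolding zeta_pow_eq_iff using p_gt_1 by (simp add: cong_def)
  qed
  with j show ?thesis using that by blast
qed

section \<open>The character for \<open>p = 2\<close>\<close>

text \<open>Since \<alpha> may fail to preserve \<open>kern n\<close>, the argument runs on its
  square \<beta>, which preserves it and also has period \<open>q\<close>. Once \<beta> is trivial,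
  so is \<alpha>, because \<open>q\<close> is odd.\<close>

lemma automorphism_2_power:
  assumes 2: "p = 2" and "\<alpha> \<in> auto (TG n)" "prime q" "q \<noteq> 2"
    and "\<And>x. x \<in> tower n \<Longrightarrow> (\<alpha> ^^ q) x = x" and "x \<in> tower n"
  shows "\<alpha> x = x"
  using assms(2-)
proof (induction n arbitrary: \<alpha> x)
  case 0
  have "\<alpha> x \<in> carrier (TG 0)" using 0(5) by (intro auto_closed[OF 0(1)]) (simp add: id_def)
  then show ?case using 0(5) by (simp add: id_def)
next
  case (Suc n)
  note \<alpha> = Suc.prems(1)
  let ?T = "tower (Suc n)"
  define \<beta> where "\<beta> = compose ?T \<alpha> \<alpha>"
  have \<beta>: "\<beta> \<in> auto (TG (Suc n))"
    using group.compose_auto[OF group_TG \<alpha> \<alpha>] by (simp add: \<beta>_def)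
  have \<alpha>T: "\<alpha> x \<in> ?T" if "x \<in> ?T" for x using auto_closed[OF \<alpha>] that by simp
  have \<beta>x: "\<beta> x = \<alpha> (\<alpha> x)" if "x \<in> ?T" for x using that by (simp add: \<beta>_def compose_def)
  have pow: "(\<beta> ^^ i) x = (\<alpha> ^^ (2 * i)) x \<and> (\<alpha> ^^ (2 * i)) x \<in> ?T" if "x \<in> ?T" for i x
    using that by (induction i) (auto simp: \<beta>x \<alpha>T)
  have \<beta>q: "(\<beta> ^^ q) x = x" if x: "x \<in> ?T" for x
  proof -
    have "(\<alpha> ^^ (q + q)) x = x" using Suc.prems(4) x by (simp add: funpow_add)
    then show ?thesis using pow[OF x, of q] by (simp add: mult_2)
  qed
  have k: "\<beta> ` kern n \<subseteq> kern n"
    using auto_square_preserves_kern[OF 2 \<alpha>] \<beta>x kern_le by (auto simp: image_image subset_iff)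
  have "dsc n \<beta> y = y" if "y \<in> tower n" for y
    using Suc.IH[OF dsc_auto[OF \<beta> k] Suc.prems(2,3) dsc_funpow[OF \<beta> k \<beta>q] that] by blast
  moreover have "\<beta> (zeta n) = zeta n"
  proof -
    obtain j where j: "\<beta> (zeta n) = zeta n ^^ j" "\<not> p dvd j" using \<beta> by (rule auto_zeta)
    \<comment> \<open>Modulo 2 the only exponent prime to 2 is 1, so the center is fixed
      pointwise.\<close>
    then have "[j = 1] (mod p)" by (simp add: 2 cong_def odd_iff_mod_2_eq_one)
    then have "zeta n ^^ j = zeta n ^^ 1" unfolding zeta_pow_eq_iff .
    with j show ?thesis by simp
  qed
  ultimately have \<beta>_id: "\<beta> x = x" if "x \<in> ?T" for x
    using automorphism_trivial[OF \<beta> k Suc.prems(2) _ \<beta>q _ _ that] Suc.prems(3) 2 by blast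
  have "odd q" using Suc.prems(2,3) by (metis prime_nat_iff primes_dvd_imp_eq two_is_prime_nat)
  then obtain i where i: "q = 2 * i + 1" by (elim oddE)
  have "(\<beta> ^^ i) y = y" if "y \<in> ?T" for y using that \<beta>_id by (induction i) auto
  then have "(\<alpha> ^^ (2 * i)) x = x" using pow Suc.prems(5) by metis
  then have "(\<alpha> ^^ q) x = \<alpha> x" by (simp add: i)
  then show ?case using Suc.prems(4,5) by simp
qed

text \<open>The target group is trivial, so the identity realises its only vector; the clause on
  automorphisms of prime order is \<open>automorphism_2_power\<close>.\<close>

lemma diagonal_character_two:
  assumes 2: "p = 2"
  shows "diagonal_character p n (Sym (pts n)) (tower n) (\<lambda>_. \<one>\<^bsub>cyclic_power (p - 1) n\<^esub>)"
proof -
  let ?C = "cyclic_power (p - 1) n"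
  have "{0..<1::int} = {0}" by auto
  then have C: "carrier ?C = {\<one>\<^bsub>?C\<^esub>}"
    by (simp add: 2 carrier_cyclic_power one_cyclic_power PiE_eq_singleton)
  have "\<exists>g\<in>carrier (Sym (pts n)). \<forall>x\<in>tower n. g \<otimes>\<^bsub>Sym (pts n)\<^esub> x \<otimes>\<^bsub>Sym (pts n)\<^esub> inv\<^bsub>Sym (pts n)\<^esub> g \<in> tower n"
    by (rule bexI[of _ id]) (simp_all add: permutes_id inv_Sym)
  moreover have "(\<lambda>_. \<one>\<^bsub>?C\<^esub>) \<in> hom (AutoGroup (TG n)) ?C"
    by (rule homI) (simp_all add: C group.is_monoid monoid.r_one)
  ultimately show ?thesis
    unfolding diagonal_character_def C using automorphism_2_power[OF 2] 2 by auto
qed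

section \<open>Scaling maps in the normalizer of the tower\<close>

definition sc :: "nat \<Rightarrow> int \<Rightarrow> (int list \<Rightarrow> int list) \<Rightarrow> int list \<Rightarrow> int list"
  where "sc n a g l = (if l \<in> pts (Suc n) then ((a * hd l) mod int p) # g (tl l) else l)"

lemma sc_Cons: "0 \<le> z \<Longrightarrow> z < int p \<Longrightarrow> x \<in> pts n \<Longrightarrow> sc n a g (z # x) = ((a * z) mod int p) # g x"
  by (simp add: sc_def)

lemma sc_outside: "l \<notin> pts (Suc n) \<Longrightarrow> sc n a g l = l"
  by (simp add: sc_def)

lemma sc_comp:
  assumes "g' permutes pts n"
  shows "sc n a g \<circ> sc n a' g' = sc n (a * a') (g \<circ> g')"
proof
  fix l show "(sc n a g \<circ> sc n a' g') l = sc n (a * a') (g \<circ> g') l"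
  proof (cases "l \<in> pts (Suc n)")
    case True
    then obtain z x where "l = z # x" "0 \<le> z" "z < int p" "x \<in> pts n" by (rule pts_SucE)
    moreover from this have "g' x \<in> pts n" using assms permutes_in_image by metis
    ultimately show ?thesis by (simp add: sc_Cons mod_simps mult.assoc)
  qed (simp add: sc_outside)
qed

lemma sc_permutes:
  assumes g: "g permutes pts n" and a: "coprime a (int p)"
  shows "sc n a g permutes pts (Suc n)"
proof (rule bij_imp_permutes)
  obtain b where b: "[a * b = 1] (mod int p)" using cong_solve_coprime_int[OF a] by auto
  let ?h = "sc n b (inv' g)"
  have ig: "inv' g permutes pts n" using g by (rule permutes_inv)
  have one: "sc n c id = id" if "[c = 1] (mod int p)" for c
  proof
    fix l show "sc n c id l = id l"
    proof (cases "l \<in> pts (Suc n)")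
      case True
      then obtain z x where l: "l = z # x" "0 \<le> z" "z < int p" "x \<in> pts n" by (rule pts_SucE)
      have "[c * z = 1 * z] (mod int p)" using \<open>[c = 1] (mod int p)\<close> by (rule cong_scalar_right)
      then show ?thesis using l by (simp add: sc_Cons cong_def)
    qed (simp add: sc_outside)
  qed
  have "sc n a g \<circ> ?h = id" "?h \<circ> sc n a g = id"
    unfolding sc_comp[OF ig] sc_comp[OF g] permutes_inv_o[OF g]
    using b by (simp_all only: one mult.commute)
  then show "bij_betw (sc n a g) (pts (Suc n)) (pts (Suc n))"
  proof (intro bij_betwI[where g = ?h])
    show "sc n a g \<in> pts (Suc n) \<rightarrow> pts (Suc n)" "?h \<in> pts (Suc n) \<rightarrow> pts (Suc n)"
      using permutes_in_image[OF g] permutes_in_image[OF ig]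
      by (auto elim!: pts_SucE simp: sc_Cons)
  qed (auto simp: fun_eq_iff)
qed (simp add: sc_outside)

lemma sc_wr:
  assumes g: "g permutes pts n" and h: "h permutes pts n"
  shows "sc n a g \<circ> wr n f h = wr n (\<lambda>x. a * f (inv' g x)) (g \<circ> h \<circ> inv' g) \<circ> sc n a g"
proof
  fix l show "(sc n a g \<circ> wr n f h) l = (wr n (\<lambda>x. a * f (inv' g x)) (g \<circ> h \<circ> inv' g) \<circ> sc n a g) l"
  proof (cases "l \<in> pts (Suc n)")
    case True
    then obtain z x where "l = z # x" "0 \<le> z" "z < int p" "x \<in> pts n" by (rule pts_SucE)
    moreover from this have "g x \<in> pts n" "h x \<in> pts n"
      using permutes_in_image[OF g] permutes_in_image[OF h] by auto
    ultimately show ?thesis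
      using permutes_inverses(2)[OF g] by (simp add: sc_Cons wr_Cons mod_simps distrib_left)
  qed (simp add: sc_outside wr_outside)
qed

text \<open>Conjugation multiplies the shift function by \<open>a\<close>, hence acts on
  \<open>zeta n\<close> as raising to the power \<open>a\<close>, and it induces conjugation by
  \<open>g\<close> on tails.\<close>

lemma conj_sc:
  assumes g: "g permutes pts n" and a: "coprime a (int p)" and h: "h permutes pts n"
  shows "sc n a g \<otimes>\<^bsub>Sym (pts (Suc n))\<^esub> wr n f h \<otimes>\<^bsub>Sym (pts (Suc n))\<^esub> inv\<^bsub>Sym (pts (Suc n))\<^esub> (sc n a g)
    = wr n (\<lambda>x. a * f (inv' g x)) (g \<circ> h \<circ> inv' g)"
  unfolding mult_Sym inv_Sym[OF sc_permutes[OF g a]] sc_wr[OF g h] comp_assoc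
    permutes_inv_o(1)[OF sc_permutes[OF g a]] by simp

section \<open>The character for odd \<open>p\<close>\<close>

text \<open>Discrete logarithm to base \<open>r\<close> of the exponent by which \<alpha> acts on
  the center. For a primitive root \<open>r\<close> it turns composition into addition modulo
  \<open>p - 1\<close>.\<close>

definition zexp :: "nat \<Rightarrow> nat \<Rightarrow> ((int list \<Rightarrow> int list) \<Rightarrow> int list \<Rightarrow> int list) \<Rightarrow> nat"
  where "zexp n r \<alpha> = (THE e. e < p - 1 \<and> \<alpha> (zeta n) = zeta n ^^ (r ^ e))"

context
  fixes r
  assumes r: "residue_primroot p r"
begin

lemma primroot_cong_iff: "[r ^ i = r ^ j] (mod p) \<longleftrightarrow> [i = j] (mod (p - 1))"
  using r order_divides_expdiff[of p r] prime_p
  by (simp add: residue_primroot_def totient_prime)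

lemma zexp_unique:
  assumes "\<alpha> (zeta n) = zeta n ^^ (r ^ e)"
  shows "zexp n r \<alpha> = e mod (p - 1)"
  unfolding zexp_def
proof (rule the_equality)
  have "[r ^ (e mod (p - 1)) = r ^ e] (mod p)" unfolding primroot_cong_iff by simp
  then have "zeta n ^^ (r ^ (e mod (p - 1))) = zeta n ^^ (r ^ e)" unfolding zeta_pow_eq_iff .
  then show "e mod (p - 1) < p - 1 \<and> \<alpha> (zeta n) = zeta n ^^ (r ^ (e mod (p - 1)))"
    using assms p_gt_1 by simp
  fix i assume i: "i < p - 1 \<and> \<alpha> (zeta n) = zeta n ^^ (r ^ i)"
  then have "zeta n ^^ (r ^ i) = zeta n ^^ (r ^ e)" using assms by metis
  then have "[i = e] (mod (p - 1))" unfolding zeta_pow_eq_iff primroot_cong_iff .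
  with i show "i = e mod (p - 1)" by (simp add: cong_def)
qed

lemma zexp:
  assumes "\<alpha> \<in> auto (TG (Suc n))"
  shows "zexp n r \<alpha> < p - 1" "\<alpha> (zeta n) = zeta n ^^ (r ^ zexp n r \<alpha>)"
proof -
  obtain j where j: "\<alpha> (zeta n) = zeta n ^^ j" "\<not> p dvd j" using assms by (rule auto_zeta)
  have "j mod p \<in> totatives p"
    using j(2) prime_p p_gt_1 by (auto simp: totatives_def coprime_commute prime_imp_coprime dvd_eq_mod_eq_0)
  moreover have "(\<lambda>i. r ^ i mod p) ` {..<p - 1} = totatives p"
    using residue_primroot_is_generator[OF p_gt_1 r] by (simp add: bij_betw_def totient_prime prime_p)
  ultimately have "j mod p \<in> (\<lambda>i. r ^ i mod p) ` {..<p - 1}" by (simp only:)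
  then obtain e where e: "e < p - 1" "r ^ e mod p = j mod p" by (elim imageE) simp
  then have "zeta n ^^ (r ^ e) = zeta n ^^ j" unfolding zeta_pow_eq_iff by (simp add: cong_def)
  then have \<alpha>: "\<alpha> (zeta n) = zeta n ^^ (r ^ e)" using j by simp
  with zexp_unique[of \<alpha> n e] e(1) show "zexp n r \<alpha> < p - 1" "\<alpha> (zeta n) = zeta n ^^ (r ^ zexp n r \<alpha>)"
    by simp_all
qed

lemma zexp_compose:
  assumes \<alpha>: "\<alpha> \<in> auto (TG (Suc n))" and \<beta>: "\<beta> \<in> auto (TG (Suc n))"
  shows "zexp n r (compose (tower (Suc n)) \<alpha> \<beta>) = (zexp n r \<alpha> + zexp n r \<beta>) mod (p - 1)"
proof (rule zexp_unique)
  have "compose (tower (Suc n)) \<alpha> \<beta> (zeta n) = \<alpha> (\<beta> (zeta n))"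
    using zeta_tower by (simp add: compose_def)
  also have "\<dots> = zeta n ^^ (r ^ (zexp n r \<alpha> + zexp n r \<beta>))"
    unfolding zexp(2)[OF \<beta>] auto_zeta_pow[OF \<alpha>] unfolding zexp(2)[OF \<alpha>] funpow_mult power_add ..
  finally show "compose (tower (Suc n)) \<alpha> \<beta> (zeta n) = zeta n ^^ (r ^ (zexp n r \<alpha> + zexp n r \<beta>))" .
qed

text \<open>Induction on the level: the new coordinate is the discrete logarithm of the action on
  the center, the old ones come from the induced automorphism, which exists because \<alpha>
  preserves \<open>kern n\<close>.\<close>

lemma diagonal_character_odd:
  assumes odd: "p \<noteq> 2"
  shows "\<exists>\<theta>. diagonal_character p n (Sym (pts n)) (tower n) \<theta>"
proof (induction n)
  case 0
  have C: "carrier (cyclic_power (p - 1) 0) = {\<one>\<^bsub>cyclic_power (p - 1) 0\<^esub>}"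
    using p_gt_1 by (simp add: carrier_cyclic_power one_cyclic_power fun_eq_iff)
  have hom: "(\<lambda>_. \<one>\<^bsub>cyclic_power (p - 1) 0\<^esub>) \<in> hom (AutoGroup (TG 0)) (cyclic_power (p - 1) 0)"
    by (rule homI) (simp_all add: C group.is_monoid monoid.r_one)
  have "\<exists>g\<in>carrier (Sym (pts 0)). \<forall>x\<in>tower 0. g \<otimes>\<^bsub>Sym (pts 0)\<^esub> x \<otimes>\<^bsub>Sym (pts 0)\<^esub> inv\<^bsub>Sym (pts 0)\<^esub> g \<in> tower 0"
    by (rule bexI[of _ id]) (simp_all add: permutes_id inv_Sym)
  then have "diagonal_character p 0 (Sym (pts 0)) (tower 0) (\<lambda>_. \<one>\<^bsub>cyclic_power (p - 1) 0\<^esub>)"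
    unfolding diagonal_character_def C using hom auto_closed[of _ "TG 0"] by auto
  then show ?case by blast
next
  case (Suc n)
  then obtain \<theta> where \<theta>: "diagonal_character p n (Sym (pts n)) (tower n) \<theta>" by blast
  let ?C = "cyclic_power (p - 1) n" and ?C' = "cyclic_power (p - 1) (Suc n)"
  let ?S = "Sym (pts (Suc n))"
  have m: "p - 1 > 0" using p_gt_1 by simp
  have \<theta>_hom: "\<theta> \<in> hom (AutoGroup (TG n)) ?C" using \<theta> by (simp add: diagonal_character_def)
  have \<theta>_closed: "\<theta> \<alpha> \<in> {..<n} \<rightarrow>\<^sub>E {0..<int (p - 1)}" if "\<alpha> \<in> auto (TG n)" for \<alpha>
    using hom_in_carrier[OF \<theta>_hom, of \<alpha>] that unfolding carrier_cyclic_power[OF m] by simp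
  define \<theta>' where "\<theta>' \<alpha> = (\<lambda>i\<in>{..<Suc n}. if i = n then int (zexp n r \<alpha>) else \<theta> (dsc n \<alpha>) i)" for \<alpha>
  have pk: "\<alpha> ` kern n \<subseteq> kern n" if "\<alpha> \<in> auto (TG (Suc n))" for \<alpha>
    using auto_preserves_kern[OF that odd] .
  have "diagonal_character p (Suc n) ?S (tower (Suc n)) \<theta>'"
    unfolding diagonal_character_def
  proof (intro conjI ballI allI impI)
    show "\<theta>' \<in> hom (AutoGroup (TG (Suc n))) ?C'"
    proof (rule homI)
      fix \<alpha> assume "\<alpha> \<in> carrier (AutoGroup (TG (Suc n)))"
      then have \<alpha>: "\<alpha> \<in> auto (TG (Suc n))" by simp
      show "\<theta>' \<alpha> \<in> carrier ?C'"
        unfolding carrier_cyclic_power[OF m] \<theta>'_def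
        using \<theta>_closed[OF dsc_auto[OF \<alpha> pk[OF \<alpha>]]] zexp(1)[OF \<alpha>] by (auto simp: PiE_iff)
    next
      fix \<alpha> \<beta> assume "\<alpha> \<in> carrier (AutoGroup (TG (Suc n)))" "\<beta> \<in> carrier (AutoGroup (TG (Suc n)))"
      then have ab: "\<alpha> \<in> auto (TG (Suc n))" "\<beta> \<in> auto (TG (Suc n))" by auto
      note d = dsc_auto[OF ab(1) pk[OF ab(1)]] dsc_auto[OF ab(2) pk[OF ab(2)]]
      have "dsc n (\<alpha> \<otimes>\<^bsub>AutoGroup (TG (Suc n))\<^esub> \<beta>) = dsc n \<alpha> \<otimes>\<^bsub>AutoGroup (TG n)\<^esub> dsc n \<beta>"
        using dsc_compose[OF ab(1) pk[OF ab(1)] ab(2) pk[OF ab(2)]]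
        unfolding mult_AutoGroup[OF ab] mult_AutoGroup[OF d] TG_simps .
      then have "\<theta> (dsc n (\<alpha> \<otimes>\<^bsub>AutoGroup (TG (Suc n))\<^esub> \<beta>)) = \<theta> (dsc n \<alpha>) \<otimes>\<^bsub>?C\<^esub> \<theta> (dsc n \<beta>)"
        using Group.hom_mult[OF \<theta>_hom, of "dsc n \<alpha>" "dsc n \<beta>"] d by simp
      moreover have "zexp n r (\<alpha> \<otimes>\<^bsub>AutoGroup (TG (Suc n))\<^esub> \<beta>) = (zexp n r \<alpha> + zexp n r \<beta>) mod (p - 1)"
        using zexp_compose[OF ab] unfolding mult_AutoGroup[OF ab] TG_simps .
      ultimately show "\<theta>' (\<alpha> \<otimes>\<^bsub>AutoGroup (TG (Suc n))\<^esub> \<beta>) = \<theta>' \<alpha> \<otimes>\<^bsub>?C'\<^esub> \<theta>' \<beta>"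
        by (auto simp: \<theta>'_def mult_cyclic_power fun_eq_iff zmod_int)
    qed
  next
    fix \<alpha> q x
    assume \<alpha>: "\<alpha> \<in> auto (TG (Suc n))" and q: "prime q" "q \<noteq> p" and one: "\<theta>' \<alpha> = \<one>\<^bsub>?C'\<^esub>"
      and per: "\<forall>x\<in>tower (Suc n). (\<alpha> ^^ q) x = x" and x: "x \<in> tower (Suc n)"
    have per': "(\<alpha> ^^ q) x = x" if "x \<in> tower (Suc n)" for x using per that by blast
    have ptw: "\<theta>' \<alpha> i = 0" if "i < Suc n" for i using one that by (simp add: one_cyclic_power)
    have "zexp n r \<alpha> = 0" using ptw[of n] by (simp add: \<theta>'_def)
    then have top: "\<alpha> (zeta n) = zeta n" using zexp(2)[OF \<alpha>] by simp
    note d = dsc_auto[OF \<alpha> pk[OF \<alpha>]]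
    have "\<theta> (dsc n \<alpha>) = \<one>\<^bsub>?C\<^esub>"
      unfolding one_cyclic_power
    proof (rule PiE_ext[OF \<theta>_closed[OF d]])
      show "(\<lambda>i\<in>{..<n}. 0) \<in> {..<n} \<rightarrow>\<^sub>E {0..<int (p - 1)}" using m by auto
      fix i assume "i \<in> {..<n}"
      then show "\<theta> (dsc n \<alpha>) i = (\<lambda>i\<in>{..<n}. 0) i" using ptw[of i] by (simp add: \<theta>'_def)
    qed
    moreover have "\<forall>y\<in>tower n. (dsc n \<alpha> ^^ q) y = y"
      using dsc_funpow[OF \<alpha> pk[OF \<alpha>] per'] by blast
    ultimately have "\<And>y. y \<in> tower n \<Longrightarrow> dsc n \<alpha> y = y"
      using \<theta> d q unfolding diagonal_character_def by blast
    then show "\<alpha> x = x" using automorphism_trivial[OF \<alpha> pk[OF \<alpha>] q per' top _ x] by blast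
  next
    fix v assume "v \<in> carrier ?C'"
    then have v: "v \<in> {..<Suc n} \<rightarrow>\<^sub>E {0..<int (p - 1)}" by (simp only: carrier_cyclic_power[OF m])
    define e where "e = nat (v n)"
    have vn: "0 \<le> v n" "v n < int (p - 1)" using v PiE_mem[OF v, of n] by auto
    then have e: "int e = v n" "e < p - 1" by (auto simp: e_def)
    \<comment> \<open>The induction hypothesis gives \<open>g\<close> for the first \<open>n\<close>
      coordinates; scaling the head by \<open>r ^ e\<close> realises the last one.\<close>
    have "restrict v {..<n} \<in> carrier ?C"
      unfolding carrier_cyclic_power[OF m] using v by (auto simp: PiE_iff)
    then obtain g where g: "g permutes pts n"
      and gT: "\<And>x. x \<in> tower n \<Longrightarrow> g \<otimes>\<^bsub>Sym (pts n)\<^esub> x \<otimes>\<^bsub>Sym (pts n)\<^esub> inv\<^bsub>Sym (pts n)\<^esub> g \<in> tower n"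
      and g\<theta>: "\<theta> (conj_on (Sym (pts n)) (tower n) g) = restrict v {..<n}"
      using \<theta> unfolding diagonal_character_def carrier_Sym mem_Collect_eq by blast
    have gT': "g \<circ> h \<circ> inv' g \<in> tower n" if "h \<in> tower n" for h
      using gT[OF that] unfolding mult_Sym inv_Sym[OF g] .
    define a where "a = int (r ^ e)"
    have "coprime r p" using r by (simp add: residue_primroot_def coprime_commute)
    then have a: "coprime a (int p)" by (simp add: a_def)
    define s where "s = sc n a g"
    have sp: "s permutes pts (Suc n)" unfolding s_def by (rule sc_permutes[OF g a])
    have cs: "s \<otimes>\<^bsub>?S\<^esub> wr n f h \<otimes>\<^bsub>?S\<^esub> inv\<^bsub>?S\<^esub> s = wr n (\<lambda>x. a * f (inv' g x)) (g \<circ> h \<circ> inv' g)"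
      if "h \<in> tower n" for f h
      unfolding s_def by (rule conj_sc[OF g a tower_permutes[OF that]])
    have sT: "s \<otimes>\<^bsub>?S\<^esub> x \<otimes>\<^bsub>?S\<^esub> inv\<^bsub>?S\<^esub> s \<in> tower (Suc n)" if x: "x \<in> tower (Suc n)" for x
    proof -
      obtain f h where "h \<in> tower n" "x = wr n f h" using x by (rule tower_SucE)
      then show ?thesis using cs wr_tower[OF gT'] by metis
    qed
    let ?c = "conj_on ?S (tower (Suc n)) s"
    have c_auto: "?c \<in> auto (TG (Suc n))"
      by (rule group.conj_on_auto[OF group_Sym subgroup_tower finite_tower _ sT]) (simp_all add: sp)
    have g_auto: "conj_on (Sym (pts n)) (tower n) g \<in> auto (TG n)"
      by (rule group.conj_on_auto[OF group_Sym subgroup_tower finite_tower _ gT]) (simp_all add: g)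
    have "?c (zeta n) = wr n (\<lambda>x. a * 1) (g \<circ> id \<circ> inv' g)"
      using zeta_tower cs[OF tower_id, of "\<lambda>_. 1"] unfolding zeta_def[symmetric] by (simp add: conj_on_def)
    also have "\<dots> = zeta n ^^ (r ^ e)"
      unfolding zeta_pow a_def comp_id permutes_inv_o(1)[OF g] by simp
    finally have "zexp n r ?c = e" using zexp_unique e(2) by simp
    moreover have "dsc n ?c = conj_on (Sym (pts n)) (tower n) g"
    proof (rule auto_eqI[OF dsc_auto[OF c_auto pk[OF c_auto]] g_auto])
      fix h assume "h \<in> carrier (TG n)"
      then have h: "h \<in> tower n" by simp
      \<comment> \<open>The lift of \<open>h\<close> with zero shift serves as preimage under
        \<open>proj n\<close>, on which the induced map is computed.\<close>
      have w: "wr n (\<lambda>_. 0) h \<in> tower (Suc n)" using h by (rule wr_tower)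
      have "dsc n ?c h = dsc n ?c (proj n (wr n (\<lambda>_. 0) h))"
        unfolding proj_wr[OF tower_permutes[OF h]] ..
      also have "\<dots> = proj n (?c (wr n (\<lambda>_. 0) h))" by (rule dsc_proj[OF c_auto pk[OF c_auto] w])
      also have "?c (wr n (\<lambda>_. 0) h) = wr n (\<lambda>x. a * 0) (g \<circ> h \<circ> inv' g)"
        using w cs[OF h, of "\<lambda>_. 0"] by (simp only: conj_on_def restrict_apply')
      also have "proj n \<dots> = g \<circ> h \<circ> inv' g" by (rule proj_wr[OF tower_permutes[OF gT'[OF h]]])
      also have "\<dots> = conj_on (Sym (pts n)) (tower n) g h"
        using h by (simp only: conj_on_def restrict_apply' mult_Sym inv_Sym[OF g])
      finally show "dsc n ?c h = conj_on (Sym (pts n)) (tower n) g h" .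
    qed
    ultimately have "\<theta>' ?c i = v i" for i
      using e(1) g\<theta> v by (auto simp: \<theta>'_def PiE_iff extensional_def)
    then have "\<theta>' ?c = v" by blast
    then show "\<exists>g\<in>carrier ?S. (\<forall>x\<in>tower (Suc n). g \<otimes>\<^bsub>?S\<^esub> x \<otimes>\<^bsub>?S\<^esub> inv\<^bsub>?S\<^esub> g \<in> tower (Suc n))
        \<and> \<theta>' (conj_on ?S (tower (Suc n)) g) = v"
      using sp sT by (intro bexI[of _ s]) auto
  qed
  then show ?case by blast
qed

end

lemma diagonal_character_tower: "\<exists>\<theta>. diagonal_character p n (Sym (pts n)) (tower n) \<theta>"
proof (cases "p = 2")
  case True
  then show ?thesis using diagonal_character_two by blast
next
  case False
  obtain r where "residue_primroot p r" using prime_primitive_root_exists[OF _ prime_p] p_gt_1 by auto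
  then show ?thesis using False by (rule diagonal_character_odd)
qed

end

section \<open>Transfer from the tower to an arbitrary Sylow subgroup\<close>

theorem proposition1p3:
  fixes p n :: nat and P :: "(nat \<Rightarrow> nat) set"
  assumes "prime p"
    and "n \<ge> 1"
    and "sylow_subgroup p P (sym_group (p ^ n))"
  shows "centralizer (sym_group (p ^ n)) P = center (sym_group (p ^ n)\<lparr>carrier := P\<rparr>)
    \<and> (sym_group (p ^ n)\<lparr>carrier := normalizer (sym_group (p ^ n)) P\<rparr>) Mod P
          \<cong> cyclic_power (p - 1) n
    \<and> (\<exists>Q. sylow_subgroup p Q (AutoGroup (sym_group (p ^ n)\<lparr>carrier := P\<rparr>))
          \<and> Q \<lhd> AutoGroup (sym_group (p ^ n)\<lparr>carrier := P\<rparr>)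
          \<and> (AutoGroup (sym_group (p ^ n)\<lparr>carrier := P\<rparr>)) Mod Q \<cong> cyclic_power (p - 1) n)
    \<and> (p = 2 \<longrightarrow> finite_p_group 2 (AutoGroup (sym_group (p ^ n)\<lparr>carrier := P\<rparr>))
          \<and> normalizer (sym_group (p ^ n)) P = P)"
proof -
  interpret sylow_tower p by unfold_locales (rule assms(1))
  let ?S = "sym_group (p ^ n)" and ?T = "Sym (pts n)"
  interpret S: group ?S by (rule sym_group_is_group)
  \<comment> \<open>Any bijection between the words and \<open>{1..p ^ n}\<close> carries the tower
    to a Sylow subgroup \<open>Q\<close> of the given symmetric group.\<close>
  have "card (pts n) = card {1..p ^ n}" by (simp add: card_pts)
  then obtain \<phi> where \<phi>: "bij_betw \<phi> (pts n) {1..p ^ n}"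
    using finite_same_card_bij[OF finite_pts finite_atLeastAtMost] by blast
  then obtain \<psi> where \<psi>: "\<psi> \<in> iso ?T ?S" using Sym_iso unfolding sym_group_eq_Sym by blast
  interpret \<psi>: group_hom ?T ?S \<psi>
    using \<psi> S.group_axioms by (simp add: group_hom_def group_hom_axioms_def iso_def)
  define Q where "Q = \<psi> ` tower n"
  have Tc: "tower n \<subseteq> carrier ?T" using subgroup_tower by (rule subgroup.subset)
  have subQ: "subgroup Q ?S" unfolding Q_def by (rule \<psi>.subgroup_img_is_subgroup[OF subgroup_tower])
  have "sylow_subgroup p Q ?S"
  proof -
    have "inj_on \<psi> (carrier ?T)" "\<psi> ` carrier ?T = carrier ?S"
      using \<psi> by (auto simp: iso_def bij_betw_def)
    then have "card Q = card (tower n)" "order ?S = order ?T"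
      unfolding Q_def order_def by (metis card_image inj_on_subset Tc)+
    with subQ tower_sylow[of n] assms(3) show ?thesis by (simp add: sylow_subgroup_def)
  qed
  then obtain c where c: "c \<in> carrier ?S" "P = (\<lambda>x. c \<otimes>\<^bsub>?S\<^esub> x \<otimes>\<^bsub>?S\<^esub> inv\<^bsub>?S\<^esub> c) ` Q"
    using S.sylow_subgroups_conjugate[OF assms(1,3)] by blast
  note conj = S.conjugation_iso[OF c(1)]
  \<comment> \<open>The character travels along \<psi> from \<open>tower n\<close> to
    \<open>Q\<close>, then along conjugation by \<open>c\<close> to \<open>P\<close>;
    \<open>centralizer_iso_le\<close> takes the same route.\<close>
  obtain \<theta> where \<theta>: "diagonal_character p n ?T (tower n) \<theta>" using diagonal_character_tower by blast
  obtain \<theta>' where \<theta>': "diagonal_character p n ?S Q \<theta>'"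
    using diagonal_character_iso[OF group_Sym S.group_axioms \<psi> subgroup_tower \<theta>] unfolding Q_def by blast
  obtain \<theta>'' where \<theta>'': "diagonal_character p n ?S P \<theta>''"
    using diagonal_character_iso[OF S.group_axioms S.group_axioms conj subQ \<theta>'] unfolding c(2) by blast
  have "centralizer ?S Q \<subseteq> Q"
    unfolding Q_def by (rule centralizer_iso_le[OF \<psi> Tc centralizer_tower group_Sym])
  then have "centralizer ?S P \<subseteq> P"
    unfolding c(2) by (rule centralizer_iso_le[OF conj subgroup.subset[OF subQ] _ S.group_axioms])
  then interpret sylow_with_character ?S p n P \<theta>''
    using assms(1,3) \<theta>'' by unfold_locales
  show ?thesis using structure_of_normalizer_and_automorphisms by blast
qed

end
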